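(* Consider the locally connected two-dimensional hexagonal cellular downlink network described in the context, with no channel state information at the transmitters. Its optimal DoF value is $6/7$ DoF per cell.
   Context: Cells are placed on a hexagonal grid; each cell shares a boundary with 6 neighbouring cells. Each cell has one single-antenna base station and six single-antenna users, one located on each of its 6 boundaries. Each base station has 6 independent messages, one for each of its users. A user on the boundary between two adjacent cells hears exactly the two base stations of those cells and no others. At channel use $n$, receiver $r$ observes $Y_r(n)=\sum_{t} c_{rt}H_{rt}(n)X_t(n)+Z_r(n)$, with $c_{rt}\in\{0,1\}$ the fixed connectivity indicator just described, complex channel coefficients $H_{rt}(n)$ with magnitudes in a fixed interval bounded away from $0$ and $\infty$ (otherwise arbitrary), i.i.d. zero-mean unit-variance circularly symmetric complex Gaussian noise $Z_r(n)$, and power constraint $E|X_t|^2\le P$. Each receiver knows its channels from the transmitters it hears. No CSIT: transmitters know the connectivity but not channel realizations. The DoF of a message is its rate normalized by $\log P$ as $P\to\infty$; DoF per cell is the sum of the DoF of a cell's messages, measured symmetrically, i.e., the largest value that all cells can simultaneously achieve. *)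

theory Defs
  imports "HOL-Probability.Probability"
begin

(* Cells of the hexagonal grid, in axial coordinates. *)
type_synonym cell = "int \<times> int"

definition hex_dir :: "nat \<Rightarrow> int \<times> int" where
  "hex_dir k = [(1,0), (1,-1), (0,-1), (-1,0), (-1,1), (0,1)] ! k"

definition nbr :: "cell \<Rightarrow> nat \<Rightarrow> cell" where
  "nbr c k = (fst c + fst (hex_dir k), snd c + snd (hex_dir k))"

definition cgauss :: "complex measure" where
  "cgauss = density lborel (\<lambda>z. ennreal (exp (- (cmod z)\<^sup>2) / pi))"

definition noise :: "nat \<Rightarrow> (nat \<Rightarrow> complex) measure" where
  "noise N = PiM {..<N} (\<lambda>_. cgauss)"

(* Message tuples of cell c: one message per user k < 6, message k in {0..<M c k}. *)
definition msg_space :: "(cell \<Rightarrow> nat \<Rightarrow> nat) \<Rightarrow> cell \<Rightarrow> (nat \<Rightarrow> nat) set" where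
  "msg_space M c = PiE {..<6} (\<lambda>k. {..<M c k})"

(* Received block at user (c,k), which hears BS c (channel h1) and BS nbr c k (channel h2). *)
definition rx :: "nat \<Rightarrow> (nat \<Rightarrow> complex) \<Rightarrow> (nat \<Rightarrow> complex) \<Rightarrow> (nat \<Rightarrow> complex)
                   \<Rightarrow> (nat \<Rightarrow> complex) \<Rightarrow> (nat \<Rightarrow> complex) \<Rightarrow> (nat \<Rightarrow> complex)" where
  "rx N h1 h2 x1 x2 z = (\<lambda>n\<in>{..<N}. h1 n * x1 n + h2 n * x2 n + z n)"

(* Average (over uniform independent messages and Gaussian noise) probability that user (c,k)
   decodes its own message incorrectly.  Only the messages of the two heard BSs matter. *)
definition err_prob ::
  "nat \<Rightarrow> (cell \<Rightarrow> nat \<Rightarrow> nat) \<Rightarrow> (cell \<Rightarrow> (nat \<Rightarrow> nat) \<Rightarrow> nat \<Rightarrow> complex)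
   \<Rightarrow> (cell \<Rightarrow> nat \<Rightarrow> (nat \<Rightarrow> complex) \<Rightarrow> (nat \<Rightarrow> complex) \<Rightarrow> (nat \<Rightarrow> complex) \<Rightarrow> nat)
   \<Rightarrow> (nat \<Rightarrow> complex) \<Rightarrow> (nat \<Rightarrow> complex) \<Rightarrow> cell \<Rightarrow> nat \<Rightarrow> real" where
  "err_prob N M enc dec h1 h2 c k =
     (\<Sum>w1\<in>msg_space M c. \<Sum>w2\<in>msg_space M (nbr c k).
        measure (noise N)
          {z \<in> space (noise N).
             dec c k h1 h2 (rx N h1 h2 (enc c w1) (enc (nbr c k) w2) z) \<noteq> w1 k})
     / real (card (msg_space M c) * card (msg_space M (nbr c k)))"

definition admissible :: "real \<Rightarrow> real \<Rightarrow> (nat \<Rightarrow> complex) \<Rightarrow> bool" where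
  "admissible a b h \<longleftrightarrow> (\<forall>n. a \<le> cmod (h n) \<and> cmod (h n) \<le> b)"

(* A length-N code for the whole network with no CSIT: encoders depend only on the own
   messages (not on channels); decoder of user (c,k) depends on its own two channel sequences
   and its received block (and must be measurable in the latter).  Power constraint P, and the
   error probability of every user is at most eps for every admissible channel realization. *)
definition good_code ::
  "real \<Rightarrow> real \<Rightarrow> real \<Rightarrow> real \<Rightarrow> nat \<Rightarrow> (cell \<Rightarrow> nat \<Rightarrow> nat)
   \<Rightarrow> (cell \<Rightarrow> (nat \<Rightarrow> nat) \<Rightarrow> nat \<Rightarrow> complex)
   \<Rightarrow> (cell \<Rightarrow> nat \<Rightarrow> (nat \<Rightarrow> complex) \<Rightarrow> (nat \<Rightarrow> complex) \<Rightarrow> (nat \<Rightarrow> complex) \<Rightarrow> nat) \<Rightarrow> bool" where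
  "good_code a b P eps N M enc dec \<longleftrightarrow>
     0 < N \<and>
     (\<forall>c k. k < 6 \<longrightarrow> 1 \<le> M c k) \<and>
     (\<forall>c. (\<Sum>w\<in>msg_space M c. \<Sum>n<N. (cmod (enc c w n))\<^sup>2)
            / real (card (msg_space M c) * N) \<le> P) \<and>
     (\<forall>c k h1 h2. k < 6 \<longrightarrow>
        dec c k h1 h2 \<in> measurable (PiM {..<N} (\<lambda>_. borel)) (count_space UNIV)) \<and>
     (\<forall>c k h1 h2. k < 6 \<longrightarrow> admissible a b h1 \<longrightarrow> admissible a b h2 \<longrightarrow>
        err_prob N M enc dec h1 h2 c k \<le> eps)"

definition cell_rate_achievable :: "real \<Rightarrow> real \<Rightarrow> real \<Rightarrow> real \<Rightarrow> bool" where
  "cell_rate_achievable a b P r \<longleftrightarrow>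
     (\<forall>eps>0. \<exists>N M enc dec. good_code a b P eps N M enc dec \<and>
        (\<forall>c. r \<le> (\<Sum>k<6. ln (real (M c k))) / real N))"

definition cell_capacity :: "real \<Rightarrow> real \<Rightarrow> real \<Rightarrow> real" where
  "cell_capacity a b P = Sup {r. 0 \<le> r \<and> cell_rate_achievable a b P r}"

end

theory Submission
  imports Defs "HOL-Real_Asymp.Real_Asymp"
begin

text \<open>Converse. Users on a common boundary may see the same block, so for adjacent cells \<open>c\<close> and
  \<open>c'\<close> the user of \<open>c'\<close> on the common boundary can be served only within what the six messages of
  \<open>c\<close> leave of a single channel use: \<open>d(c) + d(c', k') \<le> 1\<close>, where \<open>d\<close> counts degrees of freedom. Adding
  this over the six neighbours of \<open>c\<close> and averaging over a large box gives \<open>6 d + d \<le> 6\<close>. Instead of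
  differential entropies, the proof compares the noise density around a codeword of bounded energy with one
  Gaussian density of variance about the received power, whose total mass is shared by the disjoint
  decoding regions.

  Achievability. Silence the cells of a perfect code of the grid, which has density \<open>1/7\<close>. Every
  other cell has exactly one silent neighbour and sends to the user on that boundary over an
  interference-free channel; the seven translates of the code take turns. Point-to-point reliability
  at fixed power comes from a square constellation of fixed spacing with an outer Gilbert--Varshamov
  code that corrects a small constant fraction of wrong symbols.\<close>

section \<open>Gaussian noise\<close>

text \<open>Circularly symmetric with mean square modulus \<open>S\<close>, not variance
  \<open>S\<close> per coordinate. \<open>S = 1\<close> gives the noise; larger \<open>S\<close>
  gives the reference output law of the converse.\<close>

definition gauss :: "real \<Rightarrow> complex measure" where
  "gauss S = density lborel (\<lambda>z. ennreal (exp (- (cmod z)\<^sup>2 / S) / (pi * S)))"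

lemma cgauss_eq_gauss: "cgauss = gauss 1"
  by (simp add: cgauss_def gauss_def)

lemma sets_gauss [simp, measurable_cong]: "sets (gauss S) = sets borel"
  by (simp add: gauss_def)

lemma space_gauss [simp]: "space (gauss S) = UNIV"
  by (simp add: gauss_def)

lemma prob_space_gauss:
  assumes "0 < S"
  shows "prob_space (gauss S)"
proof
  \<comment> \<open>The density factors over the real and imaginary parts, each a real normal of
    variance \<open>S / 2\<close>.\<close>
  let ?d = "normal_density 0 (sqrt (S / 2))"
  have "(\<Prod>b\<in>Basis. ennreal (?d (z \<bullet> b))) = ennreal (exp (- (cmod z)\<^sup>2 / S) / (pi * S))" for z
  proof -
    have s: "sqrt (S * pi) * (sqrt (S * pi) * t) = S * pi * t" for t
      using assms by (simp flip: mult.assoc)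
    have "?d (Re z) * ?d (Im z) = exp (- (Re z)\<^sup>2 / S) * exp (- (Im z)\<^sup>2 / S) / (S * pi)"
      using assms by (simp add: normal_density_def field_simps s)
    also have "exp (- (Re z)\<^sup>2 / S) * exp (- (Im z)\<^sup>2 / S) = exp (- (cmod z)\<^sup>2 / S)"
      by (simp add: cmod_power2 diff_divide_distrib flip: exp_add)
    finally show ?thesis
      by (simp add: Basis_complex_def normal_density_nonneg mult.commute flip: ennreal_mult)
  qed
  then have "emeasure (gauss S) (space (gauss S)) = (\<integral>\<^sup>+z. (\<Prod>b\<in>Basis. ennreal (?d (z \<bullet> b))) \<partial>(lborel :: complex measure))"
    by (simp add: gauss_def emeasure_density)
  also have "\<dots> = (\<Prod>b\<in>(Basis :: complex set). \<integral>\<^sup>+x. ennreal (?d x) \<partial>lborel)"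
    by (rule nn_integral_lborel_prod) auto
  also have "\<dots> = 1"
    using assms by (simp add: nn_integral_eq_integral normal_density_nonneg)
  finally show "emeasure (gauss S) (space (gauss S)) = 1" .
qed

lemma prob_space_cgauss: "prob_space cgauss"
  unfolding cgauss_eq_gauss by (rule prob_space_gauss) simp

lemma sets_cgauss [simp, measurable_cong]: "sets cgauss = sets borel"
  by (simp add: cgauss_eq_gauss)

lemma space_cgauss [simp]: "space cgauss = UNIV"
  by (simp add: cgauss_eq_gauss)

lemma prob_space_noise: "prob_space (noise N)"
  unfolding noise_def by (intro prob_space_PiM prob_space_cgauss)

lemma sets_noise [measurable_cong]: "sets (noise N) = sets (Pi\<^sub>M {..<N} (\<lambda>_. borel))"
  unfolding noise_def by (intro sets_PiM_cong) auto

lemma space_noise: "space (noise N) = (\<Pi>\<^sub>E n\<in>{..<N}. UNIV)"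
  by (simp add: noise_def space_PiM)

text \<open>Change of measure: the weight is the density of the noise centred at \<open>x\<close>
  divided by that of \<open>gauss S\<close>.\<close>

lemma emeasure_cgauss_translate:
  assumes "0 < S" and [measurable]: "A \<in> sets borel"
  shows "emeasure cgauss {z. x + z \<in> A}
    = (\<integral>\<^sup>+y. ennreal (S * exp ((cmod y)\<^sup>2 / S - (cmod (y - x))\<^sup>2)) * indicator A y \<partial>gauss S)"
proof -
  have [measurable]: "{z. x + z \<in> A} \<in> sets borel"
    using measurable_sets_borel[of "(+) x" borel A] by (simp add: vimage_def)
  have "(\<integral>\<^sup>+y. ennreal (S * exp ((cmod y)\<^sup>2 / S - (cmod (y - x))\<^sup>2)) * indicator A y \<partial>gauss S)
    = (\<integral>\<^sup>+y. ennreal (exp (- (cmod (y - x))\<^sup>2) / pi) * indicator A y \<partial>lborel)"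
    unfolding gauss_def
  proof (subst nn_integral_density, simp, simp, intro nn_integral_cong)
    fix y
    have "exp (- (cmod y)\<^sup>2 / S) / (pi * S) * (S * exp ((cmod y)\<^sup>2 / S - (cmod (y - x))\<^sup>2))
      = exp (- (cmod y)\<^sup>2 / S + ((cmod y)\<^sup>2 / S - (cmod (y - x))\<^sup>2)) / pi"
      using assms by (simp only: exp_add) simp
    also have "\<dots> = exp (- (cmod (y - x))\<^sup>2) / pi"
      by simp
    finally have "exp (- (cmod y)\<^sup>2 / S) / (pi * S) * (S * exp ((cmod y)\<^sup>2 / S - (cmod (y - x))\<^sup>2))
      = exp (- (cmod (y - x))\<^sup>2) / pi" .
    then show "ennreal (exp (- (cmod y)\<^sup>2 / S) / (pi * S)) *
        (ennreal (S * exp ((cmod y)\<^sup>2 / S - (cmod (y - x))\<^sup>2)) * indicator A y)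
      = ennreal (exp (- (cmod (y - x))\<^sup>2) / pi) * indicator A y"
      using assms by (simp flip: ennreal_mult mult.assoc)
  qed
  also have "\<dots> = (\<integral>\<^sup>+y. ennreal (exp (- (cmod (y - x))\<^sup>2) / pi) * indicator A y \<partial>distr lborel borel ((+) x))"
    by (simp add: lborel_distr_plus)
  also have "\<dots> = (\<integral>\<^sup>+z. ennreal (exp (- (cmod z)\<^sup>2) / pi) * indicator {z. x + z \<in> A} z \<partial>lborel)"
    by (subst nn_integral_distr) (auto simp: indicator_def intro!: nn_integral_cong)
  also have "\<dots> = emeasure cgauss {z. x + z \<in> A}"
    by (simp add: cgauss_def emeasure_density)
  finally show ?thesis by simp
qed

text \<open>Block version of the change of measure. Two finite measures that agree on boxes are
  equal, and on boxes both sides factor over the channel uses.\<close>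

lemma distr_noise_shift:
  assumes "0 < S"
  shows "distr (noise N) (Pi\<^sub>M {..<N} (\<lambda>_. borel)) (\<lambda>z. \<lambda>n\<in>{..<N}. x n + z n)
    = density (Pi\<^sub>M {..<N} (\<lambda>_. gauss S))
        (\<lambda>y. \<Prod>n<N. ennreal (S * exp ((cmod (y n))\<^sup>2 / S - (cmod (y n - x n))\<^sup>2)))"
    (is "?P = ?Q")
proof (rule measure_eqI_PiM_finite[where I = "{..<N}" and M = "\<lambda>_. borel"])
  interpret G: product_sigma_finite "\<lambda>_. gauss S"
    using prob_space_gauss[OF assms] prob_space_imp_sigma_finite
    by (auto simp: product_sigma_finite_def)
  interpret C: product_sigma_finite "\<lambda>_. cgauss"
    using prob_space_cgauss prob_space_imp_sigma_finite
    by (auto simp: product_sigma_finite_def)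
  interpret prob_space "noise N"
    by (rule prob_space_noise)
  show "finite {..<N}" "sets ?P = sets (Pi\<^sub>M {..<N} (\<lambda>_. borel))"
    by auto
  show "sets ?Q = sets (Pi\<^sub>M {..<N} (\<lambda>_. borel))"
    by (simp, intro sets_PiM_cong) auto
  show "range (\<lambda>i::nat. \<Pi>\<^sub>E n\<in>{..<N}. UNIV) \<subseteq> prod_algebra {..<N} (\<lambda>_. borel)"
    by (auto intro!: prod_algebraI_finite)
  show "(\<Union>i::nat. \<Pi>\<^sub>E n\<in>{..<N}. UNIV) = space (Pi\<^sub>M {..<N} (\<lambda>_. borel))"
    by (simp add: space_PiM)
  interpret P: prob_space ?P
    by (rule prob_space_distr) measurable
  show "emeasure ?P (\<Pi>\<^sub>E n\<in>{..<N}. UNIV) \<noteq> \<infinity>" for i :: nat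
    by simp
  fix A :: "nat \<Rightarrow> complex set"
  assume A: "\<And>i. i \<in> {..<N} \<Longrightarrow> A i \<in> sets borel"
  have A' [measurable]: "{z. x n + z \<in> A n} \<in> sets borel" if "n < N" for n
    using measurable_sets_borel[of "(+) (x n)" borel "A n"] A that by (simp add: vimage_def)
  have "emeasure ?P (Pi\<^sub>E {..<N} A) = emeasure (noise N) (\<Pi>\<^sub>E n\<in>{..<N}. {z. x n + z \<in> A n})"
    using A by (subst emeasure_distr)
      (auto intro!: arg_cong[where f = "emeasure (noise N)"] sets_PiM_I_finite simp: space_noise PiE_iff)
  also have "\<dots> = (\<Prod>n<N. emeasure cgauss {z. x n + z \<in> A n})"
    unfolding noise_def using A' by (subst C.emeasure_PiM) auto
  also have "\<dots> = (\<Prod>n<N. \<integral>\<^sup>+y. ennreal (S * exp ((cmod y)\<^sup>2 / S - (cmod (y - x n))\<^sup>2)) * indicator (A n) y \<partial>gauss S)"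
    using A assms by (intro prod.cong emeasure_cgauss_translate) auto
  also have "\<dots> = (\<integral>\<^sup>+y. (\<Prod>n<N. ennreal (S * exp ((cmod (y n))\<^sup>2 / S - (cmod (y n - x n))\<^sup>2)) * indicator (A n) (y n)) \<partial>Pi\<^sub>M {..<N} (\<lambda>_. gauss S))"
    using A by (subst G.product_nn_integral_prod) auto
  also have "\<dots> = (\<integral>\<^sup>+y. (\<Prod>n<N. ennreal (S * exp ((cmod (y n))\<^sup>2 / S - (cmod (y n - x n))\<^sup>2)))
      * indicator (Pi\<^sub>E {..<N} A) y \<partial>Pi\<^sub>M {..<N} (\<lambda>_. gauss S))"
    by (intro nn_integral_cong)
      (auto simp: prod.distrib space_PiM PiE_iff indicator_def intro!: prod_zero)
  also have "\<dots> = emeasure ?Q (Pi\<^sub>E {..<N} A)"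
    using A by (subst emeasure_density) (auto intro!: sets_PiM_I_finite)
  finally show "emeasure ?P (Pi\<^sub>E {..<N} A) = emeasure ?Q (Pi\<^sub>E {..<N} A)" .
qed

text \<open>For \<open>S > 1\<close> the log-likelihood ratio is a concave quadratic in
  \<open>y\<close>, so completing the square in each coordinate bounds it uniformly in
  \<open>y\<close>; \<open>y = S / (S - 1) * x\<close> attains the bound.\<close>

lemma norm_sq_diff_bound:
  fixes x y :: complex
  assumes "1 < S"
  shows "(cmod y)\<^sup>2 / S - (cmod (y - x))\<^sup>2 \<le> (cmod x)\<^sup>2 / (S - 1)"
proof -
  have *: "(u :: real)\<^sup>2 / S - (u - v)\<^sup>2 \<le> v\<^sup>2 / (S - 1)" for u v
  proof -
    have "v\<^sup>2 / (S - 1) - (u\<^sup>2 / S - (u - v)\<^sup>2) = ((S - 1) * u - S * v)\<^sup>2 / (S * (S - 1))"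
      using assms by (simp add: divide_simps) (simp add: power2_eq_square algebra_simps)
    also have "\<dots> \<ge> 0"
      using assms by auto
    finally show ?thesis by simp
  qed
  show ?thesis
    using *[of "Re y" "Re x"] *[of "Im y" "Im x"]
    by (simp add: cmod_power2 add_divide_distrib)
qed

text \<open>The density ratio never exceeds \<open>S ^ N * exp (E / (S - 1))\<close>, so this factor
  converts reference mass into an upper bound for noise mass.\<close>

lemma measure_noise_shift_le:
  assumes "1 < S" and D: "D \<in> sets (Pi\<^sub>M {..<N} (\<lambda>_. borel))"
    and E: "(\<Sum>n<N. (cmod (x n))\<^sup>2) \<le> E"
  shows "measure (noise N) {z \<in> space (noise N). (\<lambda>n\<in>{..<N}. x n + z n) \<in> D}
    \<le> S ^ N * exp (E / (S - 1)) * measure (Pi\<^sub>M {..<N} (\<lambda>_. gauss S)) D"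
proof -
  let ?G = "Pi\<^sub>M {..<N} (\<lambda>_. gauss S)"
  interpret prob_space ?G
    using assms by (intro prob_space_PiM prob_space_gauss) auto
  interpret noise: prob_space "noise N"
    by (rule prob_space_noise)
  have D': "D \<in> sets ?G"
    using D sets_PiM_cong[of "{..<N}" "{..<N}" "\<lambda>_. gauss S" "\<lambda>_. borel"] by simp
  have bound: "(\<Prod>n<N. ennreal (S * exp ((cmod (y n))\<^sup>2 / S - (cmod (y n - x n))\<^sup>2)))
    \<le> ennreal (S ^ N * exp (E / (S - 1)))" for y
  proof -
    have "(\<Prod>n<N. S * exp ((cmod (y n))\<^sup>2 / S - (cmod (y n - x n))\<^sup>2))
      \<le> (\<Prod>n<N. S * exp ((cmod (x n))\<^sup>2 / (S - 1)))"
      using assms norm_sq_diff_bound[OF assms(1)] by (intro prod_mono) auto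
    also have "\<dots> = S ^ N * exp ((\<Sum>n<N. (cmod (x n))\<^sup>2) / (S - 1))"
      by (simp add: prod.distrib exp_sum sum_divide_distrib)
    also have "\<dots> \<le> S ^ N * exp (E / (S - 1))"
      using assms by (auto intro!: mult_left_mono divide_right_mono)
    finally show ?thesis
      using assms by (subst prod_ennreal) (auto intro!: ennreal_leI)
  qed
  have "ennreal (measure (noise N) {z \<in> space (noise N). (\<lambda>n\<in>{..<N}. x n + z n) \<in> D})
    = emeasure (distr (noise N) (Pi\<^sub>M {..<N} (\<lambda>_. borel)) (\<lambda>z. \<lambda>n\<in>{..<N}. x n + z n)) D"
    using D by (subst emeasure_distr)
      (auto simp: noise.emeasure_eq_measure vimage_def Int_def conj_commute)
  also have "\<dots> = (\<integral>\<^sup>+y. (\<Prod>n<N. ennreal (S * exp ((cmod (y n))\<^sup>2 / S - (cmod (y n - x n))\<^sup>2)))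
      * indicator D y \<partial>?G)"
    using assms D' by (subst distr_noise_shift[of S]) (auto simp: emeasure_density)
  also have "\<dots> \<le> (\<integral>\<^sup>+y. ennreal (S ^ N * exp (E / (S - 1))) * indicator D y \<partial>?G)"
    by (intro nn_integral_mono mult_right_mono bound) auto
  also have "\<dots> = ennreal (S ^ N * exp (E / (S - 1)) * measure ?G D)"
    using assms D' by (simp add: nn_integral_cmult emeasure_eq_measure flip: ennreal_mult)
  finally show ?thesis
    using assms by (simp add: ennreal_le_iff)
qed

section \<open>Decoding regions and the bound for one pair of adjacent cells\<close>

text \<open>A packing bound: the same reference measure serves all codewords, and disjoint regions
  share its total mass 1.\<close>

lemma sum_measure_disjoint_regions_le:
  assumes S: "1 < S" and I: "finite I" and disj: "disjoint_family_on D I"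
    and D: "\<And>i. i \<in> I \<Longrightarrow> D i \<in> sets (Pi\<^sub>M {..<N} (\<lambda>_. borel))"
    and E: "\<And>i. i \<in> I \<Longrightarrow> (\<Sum>n<N. (cmod (x i n))\<^sup>2) \<le> E"
  shows "(\<Sum>i\<in>I. measure (noise N) {z \<in> space (noise N). (\<lambda>n\<in>{..<N}. x i n + z n) \<in> D i})
    \<le> S ^ N * exp (E / (S - 1))"
proof -
  let ?G = "Pi\<^sub>M {..<N} (\<lambda>_. gauss S)"
  interpret prob_space ?G
    using S by (intro prob_space_PiM prob_space_gauss) auto
  have sets: "sets ?G = sets (Pi\<^sub>M {..<N} (\<lambda>_. borel))"
    by (intro sets_PiM_cong) auto
  have "(\<Sum>i\<in>I. measure (noise N) {z \<in> space (noise N). (\<lambda>n\<in>{..<N}. x i n + z n) \<in> D i})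
    \<le> (\<Sum>i\<in>I. S ^ N * exp (E / (S - 1)) * measure ?G (D i))"
    using assms by (intro sum_mono measure_noise_shift_le) auto
  also have "\<dots> = S ^ N * exp (E / (S - 1)) * measure ?G (\<Union>i\<in>I. D i)"
    using I disj D by (subst finite_measure_finite_Union) (auto simp: sets sum_distrib_left)
  also have "\<dots> \<le> S ^ N * exp (E / (S - 1)) * 1"
    using S by (intro mult_left_mono) auto
  finally show ?thesis by simp
qed

section \<open>Boundaries seen from both sides, and message tuples\<close>

definition opp :: "nat \<Rightarrow> nat" where
  "opp k = (k + 3) mod 6"

lemma opp_less [simp]: "opp k < 6"
  by (simp add: opp_def)

lemma less_6_cases:
  assumes "(k :: nat) < 6"
  obtains "k = 0" | "k = 1" | "k = 2" | "k = 3" | "k = 4" | "k = 5"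
  using assms by linarith

text \<open>\<open>hex_dir\<close> lists the directions around the hexagon, so three places further
  is the reverse direction. Thus \<open>(c, k)\<close> and \<open>(nbr c k, opp k)\<close> are the
  two users on one boundary.\<close>

lemma nbr_opp: "k < 6 \<Longrightarrow> nbr (nbr c k) (opp k) = c"
  by (erule less_6_cases) (simp_all add: nbr_def opp_def hex_dir_def)

lemma finite_msg_space [simp]: "finite (msg_space M c)"
  unfolding msg_space_def by (intro finite_PiE) auto

lemma card_msg_space: "card (msg_space M c) = (\<Prod>k<6. M c k)"
  unfolding msg_space_def by (subst card_PiE) auto

text \<open>Separates one user's message from the other five, which the genie of the converse
  reveals.\<close>

lemma sum_msg_space_split:
  assumes "k < 6"
  shows "(\<Sum>w\<in>msg_space M c. f w)
    = (\<Sum>u\<in>Pi\<^sub>E ({..<6} - {k}) (\<lambda>k. {..<M c k}). \<Sum>m<M c k. f (u(k := m)))"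
proof -
  have "{..<6} = insert k ({..<6} - {k})"
    using assms by auto
  then have "msg_space M c = Pi\<^sub>E (insert k ({..<6} - {k})) (\<lambda>k. {..<M c k})"
    unfolding msg_space_def by simp
  also have "\<dots> = (\<lambda>(y, g). g(k := y)) ` ({..<M c k} \<times> Pi\<^sub>E ({..<6} - {k}) (\<lambda>k. {..<M c k}))"
    by (rule PiE_insert_eq)
  finally have "(\<Sum>w\<in>msg_space M c. f w)
    = (\<Sum>w\<in>(\<lambda>(y, g). g(k := y)) ` ({..<M c k} \<times> Pi\<^sub>E ({..<6} - {k}) (\<lambda>k. {..<M c k})). f w)"
    by simp
  also have "\<dots>
    = (\<Sum>p\<in>{..<M c k} \<times> Pi\<^sub>E ({..<6} - {k}) (\<lambda>k. {..<M c k}). f ((snd p)(k := fst p)))"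
    by (subst sum.reindex[OF inj_combinator]) (auto simp: case_prod_beta)
  also have "\<dots> = (\<Sum>m<M c k. \<Sum>u\<in>Pi\<^sub>E ({..<6} - {k}) (\<lambda>k. {..<M c k}). f (u(k := m)))"
    by (simp add: sum.cartesian_product case_prod_beta)
  also have "\<dots> = (\<Sum>u\<in>Pi\<^sub>E ({..<6} - {k}) (\<lambda>k. {..<M c k}). \<Sum>m<M c k. f (u(k := m)))"
    by (rule sum.swap)
  finally show ?thesis .
qed

section \<open>Averaging, Markov's inequality and a union bound\<close>

lemma ex_le_average:
  fixes f :: "'a \<Rightarrow> real"
  assumes "finite A" "A \<noteq> {}" "(\<Sum>x\<in>A. f x) \<le> C * real (card A)"
  shows "\<exists>x\<in>A. f x \<le> C"
proof (rule ccontr)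
  assume "\<not> (\<exists>x\<in>A. f x \<le> C)"
  then have "(\<Sum>x\<in>A. C) < (\<Sum>x\<in>A. f x)"
    using assms by (intro sum_strict_mono) auto
  with assms show False
    by (simp add: mult.commute)
qed

text \<open>Markov's inequality for the uniform distribution. The power constraint limits energy
  only on average over messages, so pairs of high energy have to be discarded by counting.\<close>

lemma markov_card:
  fixes f :: "'a \<Rightarrow> real"
  assumes "finite A" "\<And>x. x \<in> A \<Longrightarrow> 0 \<le> f x" "0 < C" "2 * (\<Sum>x\<in>A. f x) \<le> C * real (card A)"
  shows "2 * real (card {x \<in> A. C < f x}) \<le> real (card A)"
proof -
  have "real (card {x \<in> A. C < f x}) * C = (\<Sum>x\<in>{x \<in> A. C < f x}. C)"
    by simp
  also have "\<dots> \<le> (\<Sum>x\<in>{x \<in> A. C < f x}. f x)"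
    by (intro sum_mono) auto
  also have "\<dots> \<le> (\<Sum>x\<in>A. f x)"
    using assms by (intro sum_mono2) auto
  finally have "C * (2 * real (card {x \<in> A. C < f x})) \<le> C * real (card A)"
    using assms by (simp only: mult_ac)
  with \<open>0 < C\<close> show ?thesis
    by (simp only: mult_le_cancel_left_pos)
qed

lemma norm_add_sq_le:
  fixes x y :: complex
  shows "(cmod (x + y))\<^sup>2 \<le> 2 * (cmod x)\<^sup>2 + 2 * (cmod y)\<^sup>2"
proof -
  have "(cmod (x + y))\<^sup>2 + (cmod (x - y))\<^sup>2 = 2 * (cmod x)\<^sup>2 + 2 * (cmod y)\<^sup>2"
    by (simp add: cmod_power2) (simp add: power2_eq_square algebra_simps)
  then show ?thesis
    by (smt (verit) zero_le_power2)
qed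

lemma (in finite_measure) measure_subset_UN_le:
  assumes "finite I" "\<And>i. i \<in> I \<Longrightarrow> B i \<in> sets M" "A \<subseteq> B0 \<union> (\<Union>i\<in>I. B i)" "B0 \<in> sets M"
  shows "measure M A \<le> measure M B0 + (\<Sum>i\<in>I. measure M (B i))"
proof -
  have "measure M A \<le> measure M (B0 \<union> (\<Union>i\<in>I. B i))"
    using assms by (intro finite_measure_mono) auto
  also have "\<dots> \<le> measure M B0 + measure M (\<Union>i\<in>I. B i)"
    using assms by (intro measure_Un_le) auto
  also have "measure M (\<Union>i\<in>I. B i) \<le> (\<Sum>i\<in>I. measure M (B i))"
    using assms by (intro measure_UNION_le) auto
  finally show ?thesis by simp
qed

text \<open>Both users on the boundary of \<^term>\<open>c\<close> and \<^term>\<open>c'\<close> may see the same received block \<open>y\<close>.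
  Decode the message of the user of \<open>c'\<close> from \<open>y\<close>; a genie supplies the other five messages
  of \<open>c'\<close>, so its codeword can be subtracted; adding fixed codewords of the other
  neighbours of \<open>c\<close> in turn, all six messages of \<open>c\<close> are decoded as well.
  The regions are therefore disjoint for a fixed value of the genie's five messages.\<close>
lemma edge_converse:
  assumes good: "good_code a b P eps N M enc dec"
    and ab: "0 < a" "a \<le> b" and P: "0 < P" and eps: "eps \<le> 1 / 28" and k: "k < 6"
  shows "(\<Prod>j<6. real (M c j)) * real (M (nbr c k) (opp k)) \<le> 4 * (exp 1 * (1 + 8 * a\<^sup>2 * P)) ^ N"
proof -
  interpret noise: prob_space "noise N"
    by (rule prob_space_noise)
  define c' where "c' = nbr c k"
  define k' where "k' = opp k"
  define W where "W = msg_space M c"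
  define V where "V = msg_space M c'"
  \<comment> \<open>One admissible realization decides the converse: with every channel equal to
    \<open>a\<close>, the two users on the boundary receive the same sum.\<close>
  define h where "h = (\<lambda>_ :: nat. complex_of_real a)"
  define U where "U = Pi\<^sub>E ({..<6} - {k'}) (\<lambda>j. {..<M c' j})"
  \<comment> \<open>The constants are matched. The mean received energy over all message pairs is at
    most \<open>E / 2\<close>, so at most half of the pairs exceed \<open>E\<close>; and
    \<open>E / (S - 1) = N\<close>, so the exponential factor is \<open>exp 1 ^ N\<close>.\<close>
  define S where "S = 1 + 8 * a\<^sup>2 * P"
  define E where "E = 8 * a\<^sup>2 * P * real N"
  let ?B = "Pi\<^sub>M {..<N} (\<lambda>_. borel :: complex measure)"
  have k': "k' < 6" and nbr': "nbr c' k' = c"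
    using k nbr_opp by (auto simp: k'_def c'_def)
  have N: "0 < N" and M: "\<And>c k. k < 6 \<Longrightarrow> 1 \<le> M c k"
    and power: "\<And>c. (\<Sum>w\<in>msg_space M c. \<Sum>n<N. (cmod (enc c w n))\<^sup>2)
            / real (card (msg_space M c) * N) \<le> P"
    and dec [measurable]: "\<And>c k h1 h2. k < 6 \<Longrightarrow> dec c k h1 h2 \<in> measurable ?B (count_space UNIV)"
    and err: "\<And>c k h1 h2. k < 6 \<Longrightarrow> admissible a b h1 \<Longrightarrow> admissible a b h2 \<Longrightarrow>
        err_prob N M enc dec h1 h2 c k \<le> eps"
    using good unfolding good_code_def by auto
  have card_pos: "0 < card (msg_space M d)" for d
    unfolding card_msg_space using M[of _ d] by (intro prod_pos) (auto simp: Suc_le_eq)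
  have pw: "(\<Sum>w\<in>msg_space M d. \<Sum>n<N. (cmod (enc d w n))\<^sup>2) \<le> P * real (card (msg_space M d)) * real N" for d
    using power[of d] card_pos[of d] N by (simp add: field_simps)
  have h: "admissible a b h"
    using ab by (simp add: h_def admissible_def)
  define q where "q d j w v = measure (noise N) {z \<in> space (noise N).
      dec d j h h (rx N h h (enc d w) (enc (nbr d j) v) z) \<noteq> w j}" for d j w v
  have q_sum: "(\<Sum>w\<in>msg_space M d. \<Sum>v\<in>msg_space M (nbr d j). q d j w v)
      \<le> eps * real (card (msg_space M d)) * real (card (msg_space M (nbr d j)))" if "j < 6" for d j
    using err[OF that h h, of d] card_pos[of d] card_pos[of "nbr d j"]
    unfolding err_prob_def q_def[symmetric] by (simp add: field_simps)
  \<comment> \<open>For each direction \<open>j\<close> one message tuple of the interfering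
    neighbour does no worse than the average. Freezing it makes the interference at user
    \<open>j\<close> a known sequence.\<close>
  have "\<exists>v\<in>msg_space M (nbr c j). (\<Sum>w\<in>W. q c j w v) \<le> eps * real (card W)" if "j < 6" for j
    using q_sum[OF that, of c] card_pos[of "nbr c j"] sum.swap[of "q c j" _ W]
    by (intro ex_le_average) (auto simp: W_def card_gt_0_iff)
  then obtain vf where vf: "(\<Sum>w\<in>W. q c j w (vf j)) \<le> eps * real (card W)" if "j < 6" for j
    by metis
  define x where "x w v n = h n * enc c' v n + h n * enc c w n" for w v n
  define T where "T j v y = (\<lambda>n\<in>{..<N}. y n - h n * enc c' v n + h n * enc (nbr c j) (vf j) n)" for j v y
  have [measurable]: "T j v \<in> measurable ?B ?B" for j v
    unfolding T_def by measurable
  define D where "D w v = {y \<in> space ?B. dec c' k' h h y = v k' \<and> (\<forall>j\<in>{..<6}. dec c j h h (T j v y) = w j)}" for w v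
  have D: "D w v \<in> sets ?B" for w v
    using k' unfolding D_def by measurable
  define s where "s w v = measure (noise N) {z \<in> space (noise N). (\<lambda>n\<in>{..<N}. x w v n + z n) \<in> D w v}" for w v
  have rx_meas [measurable]: "rx N h h x1 x2 \<in> measurable (noise N) ?B" for x1 x2
    unfolding rx_def by measurable
  \<comment> \<open>Union bound over seven decoders, the one of \<open>c'\<close> and the six of
    \<open>c\<close>; this is the source of \<open>1 - 7 * eps\<close> below.\<close>
  have s_ge: "1 - q c' k' v w - (\<Sum>j<6. q c j w (vf j)) \<le> s w v" for w v
  proof -
    let ?A = "{z \<in> space (noise N). (\<lambda>n\<in>{..<N}. x w v n + z n) \<in> D w v}"
    have A: "?A \<in> sets (noise N)"
      using D[of w v] by measurable
    have rx1: "(\<lambda>n\<in>{..<N}. x w v n + z n) = rx N h h (enc c' v) (enc c w) z" for z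
      by (simp add: rx_def x_def)
    have rx2: "T j v (rx N h h (enc c' v) (enc c w) z) = rx N h h (enc c w) (enc (nbr c j) (vf j)) z" for z j
      by (auto simp: T_def rx_def restrict_def)
    have "measure (noise N) (space (noise N) - ?A) \<le>
        q c' k' v w + (\<Sum>j\<in>{..<6}. q c j w (vf j))"
      unfolding q_def
    proof (rule noise.measure_subset_UN_le)
      show "{z \<in> space (noise N). dec c j h h (rx N h h (enc c w) (enc (nbr c j) (vf j)) z) \<noteq> w j}
          \<in> sets (noise N)" if "j \<in> {..<6}" for j
      proof -
        have [measurable]: "dec c j h h \<in> measurable ?B (count_space UNIV)"
          using that dec by auto
        show ?thesis by measurable
      qed
      have [measurable]: "dec c' k' h h \<in> measurable ?B (count_space UNIV)"
        using k' dec by auto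
      show "{z \<in> space (noise N). dec c' k' h h (rx N h h (enc c' v) (enc (nbr c' k') w) z) \<noteq> v k'}
          \<in> sets (noise N)"
        by measurable
      show "space (noise N) - ?A \<subseteq>
        {z \<in> space (noise N). dec c' k' h h (rx N h h (enc c' v) (enc (nbr c' k') w) z) \<noteq> v k'} \<union>
        (\<Union>j<6. {z \<in> space (noise N). dec c j h h (rx N h h (enc c w) (enc (nbr c j) (vf j)) z) \<noteq> w j})"
      proof
        fix z assume z: "z \<in> space (noise N) - ?A"
        let ?y = "rx N h h (enc c' v) (enc c w) z"
        have "?y \<in> space ?B"
          by (simp add: rx_def space_PiM)
        moreover have "?y \<notin> D w v"
          using z by (simp add: rx1)
        ultimately have "dec c' k' h h ?y \<noteq> v k' \<or> (\<exists>j\<in>{..<6}. dec c j h h (T j v ?y) \<noteq> w j)"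
          unfolding D_def by blast
        with z show "z \<in> {z \<in> space (noise N). dec c' k' h h (rx N h h (enc c' v) (enc (nbr c' k') w) z) \<noteq> v k'} \<union>
          (\<Union>j<6. {z \<in> space (noise N). dec c j h h (rx N h h (enc c w) (enc (nbr c j) (vf j)) z) \<noteq> w j})"
          unfolding rx2 nbr' by blast
      qed
    qed simp
    then show ?thesis
      using noise.prob_compl[OF A] by (simp add: s_def)
  qed
  have s_le1: "s w v \<le> 1" for w v
    by (simp add: s_def)
  define en where "en w v = (\<Sum>n<N. (cmod (x w v n))\<^sup>2)" for w v
  have en_le: "en w v \<le> 2 * a\<^sup>2 * (\<Sum>n<N. (cmod (enc c' v n))\<^sup>2) + 2 * a\<^sup>2 * (\<Sum>n<N. (cmod (enc c w n))\<^sup>2)" for w v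
    unfolding en_def sum_distrib_left sum.distrib[symmetric]
  proof (rule sum_mono)
    fix n
    show "(cmod (x w v n))\<^sup>2 \<le> 2 * a\<^sup>2 * (cmod (enc c' v n))\<^sup>2 + 2 * a\<^sup>2 * (cmod (enc c w n))\<^sup>2"
      using norm_add_sq_le[of "h n * enc c' v n" "h n * enc c w n"]
      by (simp add: x_def h_def norm_mult power_mult_distrib)
  qed
  have "(\<Sum>p\<in>W \<times> V. en (fst p) (snd p)) = (\<Sum>w\<in>W. \<Sum>v\<in>V. en w v)"
    by (simp add: sum.cartesian_product case_prod_beta)
  also have "\<dots> \<le> (\<Sum>w\<in>W. \<Sum>v\<in>V. 2 * a\<^sup>2 * (\<Sum>n<N. (cmod (enc c' v n))\<^sup>2) + 2 * a\<^sup>2 * (\<Sum>n<N. (cmod (enc c w n))\<^sup>2))"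
    by (intro sum_mono en_le)
  also have "\<dots> = 2 * a\<^sup>2 * (real (card W) * (\<Sum>v\<in>V. \<Sum>n<N. (cmod (enc c' v n))\<^sup>2)
      + real (card V) * (\<Sum>w\<in>W. \<Sum>n<N. (cmod (enc c w n))\<^sup>2))"
    by (simp add: sum.distrib sum_distrib_left algebra_simps)
  also have "\<dots> \<le> 2 * a\<^sup>2 * (real (card W) * (P * real (card V) * real N)
      + real (card V) * (P * real (card W) * real N))"
    using pw[of c] pw[of c'] by (intro mult_left_mono add_mono) (auto simp: W_def V_def)
  also have "\<dots> = E / 2 * real (card (W \<times> V))"
    by (simp add: E_def card_cartesian_product algebra_simps)
  finally have en_sum: "2 * (\<Sum>p\<in>W \<times> V. en (fst p) (snd p)) \<le> E * real (card (W \<times> V))"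
    by simp
  define Bad where "Bad = {p \<in> W \<times> V. E < en (fst p) (snd p)}"
  have "E > 0"
    using ab P N by (simp add: E_def)
  have fin: "finite (W \<times> V)"
    by (simp add: W_def V_def)
  have bad: "2 * real (card Bad) \<le> real (card W) * real (card V)"
    using markov_card[OF fin _ \<open>E > 0\<close> en_sum] unfolding Bad_def
    by (simp add: en_def sum_nonneg card_cartesian_product)
  \<comment> \<open>The packing bound requires energy at most \<open>E\<close>. A pair above it
    counts 0 here and is charged as one full success in \<open>Bad\<close>.\<close>
  define g where "g w v = (if en w v \<le> E then s w v else 0)" for w v
  have "(\<Sum>v\<in>V. \<Sum>w\<in>W. 1 - q c' k' v w - (\<Sum>j<6. q c j w (vf j))) =
      real (card V) * real (card W) - (\<Sum>v\<in>V. \<Sum>w\<in>W. q c' k' v w)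
      - real (card V) * (\<Sum>j<6. \<Sum>w\<in>W. q c j w (vf j))"
    by (simp add: sum_subtractf sum.swap[of _ W])
  moreover have "(\<Sum>v\<in>V. \<Sum>w\<in>W. q c' k' v w) \<le> eps * real (card V) * real (card W)"
    using q_sum[OF k', of c'] by (simp add: nbr' V_def W_def)
  moreover have "(\<Sum>j<6. \<Sum>w\<in>W. q c j w (vf j)) \<le> (\<Sum>j<(6::nat). eps * real (card W))"
    by (intro sum_mono vf) auto
  then have "real (card V) * (\<Sum>j<6. \<Sum>w\<in>W. q c j w (vf j)) \<le> real (card V) * (6 * (eps * real (card W)))"
    by (intro mult_left_mono) auto
  ultimately have "real (card V) * real (card W) * (1 - 7 * eps)
      \<le> (\<Sum>v\<in>V. \<Sum>w\<in>W. 1 - q c' k' v w - (\<Sum>j<6. q c j w (vf j)))"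
    by (simp add: algebra_simps)
  also have "\<dots> \<le> (\<Sum>v\<in>V. \<Sum>w\<in>W. g w v + (if E < en w v then 1 else 0))"
  proof (intro sum_mono)
    fix v w
    show "1 - q c' k' v w - (\<Sum>j<6. q c j w (vf j)) \<le> g w v + (if E < en w v then 1 else 0)"
      using s_ge[of v w] s_le1[of w v] by (simp add: g_def)
  qed
  also have "\<dots> = (\<Sum>v\<in>V. \<Sum>w\<in>W. g w v) + (\<Sum>p\<in>W \<times> V. if E < en (fst p) (snd p) then 1 else 0)"
  proof -
    have "(\<Sum>p\<in>W \<times> V. if E < en (fst p) (snd p) then 1 else (0 :: real))
        = (\<Sum>w\<in>W. \<Sum>v\<in>V. if E < en w v then 1 else 0)"
      by (simp add: sum.cartesian_product case_prod_beta)
    also have "\<dots> = (\<Sum>v\<in>V. \<Sum>w\<in>W. if E < en w v then 1 else 0)"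
      by (rule sum.swap)
    finally show ?thesis
      by (simp add: sum.distrib)
  qed
  also have "(\<Sum>p\<in>W \<times> V. if E < en (fst p) (snd p) then 1 else (0 :: real)) = real (card Bad)"
    using fin by (simp add: Bad_def sum.If_cases Int_def)
  also have "(\<Sum>v\<in>V. \<Sum>w\<in>W. g w v) \<le> real (card U) * (S ^ N * exp (E / (S - 1)))"
  proof -
    have "(\<Sum>m<M c' k'. \<Sum>w\<in>W. g w (u(k' := m))) \<le> S ^ N * exp (E / (S - 1))" for u
    proof -
      let ?I = "{p \<in> {..<M c' k'} \<times> W. en (snd p) (u(k' := fst p)) \<le> E}"
      have I: "finite ?I"
        by (simp add: W_def)
      have "(\<Sum>m<M c' k'. \<Sum>w\<in>W. g w (u(k' := m)))
          = (\<Sum>p\<in>{..<M c' k'} \<times> W. g (snd p) (u(k' := fst p)))"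
        by (simp add: sum.cartesian_product case_prod_beta)
      also have "\<dots> = (\<Sum>p\<in>?I. s (snd p) (u(k' := fst p)))"
        by (simp add: g_def W_def sum.inter_filter)
      also have "\<dots> \<le> S ^ N * exp (E / (S - 1))"
        unfolding s_def
      proof (rule sum_measure_disjoint_regions_le)
        show "1 < S"
          using ab P by (simp add: S_def)
        show "disjoint_family_on (\<lambda>p. D (snd p) (u(k' := fst p))) ?I"
          unfolding disjoint_family_on_def
        proof (intro ballI impI equals0I)
          fix p p' y
          assume p: "p \<in> ?I" "p' \<in> ?I" "p \<noteq> p'"
            and y: "y \<in> D (snd p) (u(k' := fst p)) \<inter> D (snd p') (u(k' := fst p'))"
          \<comment> \<open>The order matters. The first decoder identifies the message at
            \<open>k'\<close>, hence with \<open>u\<close> the whole tuple of \<open>c'\<close>;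
            only then is \<open>T\<close> the same for both pairs, and the six decoders of
            \<open>c\<close> must agree.\<close>
          then have eq: "fst p = fst p'"
            by (auto simp: D_def)
          with y have "\<forall>j<6. snd p j = snd p' j"
            by (auto simp: D_def)
          with p have "snd p = snd p'"
            by (intro PiE_ext[of _ "{..<6}" "\<lambda>j. {..<M c j}"]) (auto simp: W_def msg_space_def)
          with eq p show False
            by (simp add: prod_eq_iff)
        qed
      qed (use I D in \<open>auto simp: en_def\<close>)
      finally show ?thesis .
    qed
    then have "(\<Sum>u\<in>U. \<Sum>m<M c' k'. \<Sum>w\<in>W. g w (u(k' := m))) \<le> (\<Sum>u\<in>U. S ^ N * exp (E / (S - 1)))"
      by (intro sum_mono)
    then show ?thesis
      unfolding V_def sum_msg_space_split[OF k'] U_def by simp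
  qed
  also have "S ^ N * exp (E / (S - 1)) = (exp 1 * S) ^ N"
    using ab P by (simp add: S_def E_def power_mult_distrib exp_of_nat_mult[symmetric] mult.commute)
  finally have main: "real (card V) * real (card W) * (1 - 7 * eps)
      \<le> real (card U) * (exp 1 * S) ^ N + real (card W) * real (card V) / 2"
    using bad by linarith
  have V: "real (card V) = real (card U) * real (M c' k')"
  proof -
    have "(\<Sum>w\<in>V. 1) = (\<Sum>u\<in>U. \<Sum>m<M c' k'. (1 :: nat))"
      unfolding V_def sum_msg_space_split[OF k'] U_def ..
    then show ?thesis
      by (simp flip: of_nat_mult)
  qed
  \<comment> \<open>\<open>eps \<le> 1 / 28\<close> leaves 3/4 of the pairs, and Markov's inequality
    removes at most 1/2. The remaining 1/4 is the factor 4 in the bound.\<close>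
  have "real (card V) * real (card W) * (3 / 4) \<le> real (card V) * real (card W) * (1 - 7 * eps)"
    using eps by (intro mult_left_mono) auto
  with main have "real (card U) * (real (card W) * real (M c' k')) \<le> real (card U) * (4 * (exp 1 * S) ^ N)"
    by (simp add: V algebra_simps)
  moreover have "0 < card U"
    using card_pos[of c'] V unfolding V_def[symmetric] by (cases "card U") auto
  ultimately have "real (card W) * real (M c' k') \<le> 4 * (exp 1 * S) ^ N"
    by simp
  then show ?thesis
    by (simp add: W_def card_msg_space S_def c'_def k'_def)
qed

section \<open>Averaging over the grid\<close>

text \<open>Bounds the logarithm of \<open>edge_converse\<close> per channel use. Keeping
  \<open>ln 4\<close> undivided costs nothing in the limit and makes the bound independent of the
  block length.\<close>

definition rate_bound :: "real \<Rightarrow> real \<Rightarrow> real" where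
  "rate_bound a P = ln 4 + 1 + ln (1 + 8 * a\<^sup>2 * P)"

text \<open>Reversing every directed edge maps the edges leaving the box onto a superset of those
  leaving its interior, so the boundary of the box needs no separate estimate.\<close>
lemma sum_box_opposite_ge:
  fixes d :: "cell \<Rightarrow> nat \<Rightarrow> real"
  assumes d: "\<And>c k. k < 6 \<Longrightarrow> 0 \<le> d c k"
  shows "(\<Sum>c\<in>{1..<n - 1} \<times> {1..<n - 1}. \<Sum>k<6. d c k)
    \<le> (\<Sum>c\<in>{0..<n} \<times> {0..<n}. \<Sum>k<6. d (nbr c k) (opp k))"
proof -
  let ?B = "{0..<n} \<times> {0..<n} :: cell set" and ?I = "{1..<n - 1} \<times> {1..<n - 1} :: cell set"
  define \<phi> where "\<phi> p = (nbr (fst p) (snd p), opp (snd p))" for p :: "cell \<times> nat"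
  have opp_opp: "opp (opp k) = k" if "k < 6" for k
    using that by (auto elim!: less_6_cases simp: opp_def)
  have inv: "\<phi> (\<phi> p) = p" if "snd p < 6" for p
    using that by (cases p) (simp add: \<phi>_def nbr_opp opp_opp)
  have inj: "inj_on \<phi> (?B \<times> {..<6})"
    by (rule inj_on_inverseI[of _ \<phi>]) (auto simp: inv)
  have sub: "?I \<times> {..<6} \<subseteq> \<phi> ` (?B \<times> {..<6})"
  proof
    fix p assume p: "p \<in> ?I \<times> {..<6::nat}"
    then have "\<phi> p \<in> ?B \<times> {..<6}"
      \<comment> \<open>A margin of one cell suffices, since each direction changes either
        coordinate by at most 1.\<close>
      by (auto simp: \<phi>_def nbr_def hex_dir_def elim!: less_6_cases)
    moreover have "p = \<phi> (\<phi> p)"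
      using p by (subst inv) auto
    ultimately show "p \<in> \<phi> ` (?B \<times> {..<6})"
      by (rule rev_image_eqI)
  qed
  have "(\<Sum>c\<in>?I. \<Sum>k<6. d c k) = (\<Sum>p\<in>?I \<times> {..<6}. d (fst p) (snd p))"
    by (simp add: sum.cartesian_product case_prod_beta)
  also have "\<dots> \<le> (\<Sum>p\<in>\<phi> ` (?B \<times> {..<6}). d (fst p) (snd p))"
    using sub by (intro sum_mono2) (auto simp: \<phi>_def intro!: d)
  also have "\<dots> = (\<Sum>p\<in>?B \<times> {..<6}. d (nbr (fst p) (snd p)) (opp (snd p)))"
    by (subst sum.reindex[OF inj]) (simp add: \<phi>_def)
  also have "\<dots> = (\<Sum>c\<in>?B. \<Sum>k<6. d (nbr c k) (opp k))"
    by (simp add: sum.cartesian_product case_prod_beta)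
  finally show ?thesis .
qed

text \<open>The six edge bounds at \<open>c\<close> limit what its neighbours address to users on
  the boundary of \<open>c\<close> to \<open>6 * (L - r)\<close>. Over the grid each message is
  counted once this way, so the average cell rate, at least \<open>r\<close>, is at most
  \<open>6 * (L - r)\<close>. The averaging is needed because rates may vary from user to user and
  cell to cell.\<close>

lemma rate_from_edge_bounds:
  fixes d :: "cell \<Rightarrow> nat \<Rightarrow> real"
  assumes d: "\<And>c k. k < 6 \<Longrightarrow> 0 \<le> d c k"
    and edge: "\<And>c k. k < 6 \<Longrightarrow> (\<Sum>j<6. d c j) + d (nbr c k) (opp k) \<le> L"
    and r: "\<And>c. r \<le> (\<Sum>j<6. d c j)"
  shows "r \<le> 6 / 7 * L"
proof -
  have cell: "(\<Sum>k<6. d (nbr c k) (opp k)) \<le> 6 * (L - r)" for c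
  proof -
    have "(\<Sum>k<6. d (nbr c k) (opp k)) \<le> (\<Sum>k<(6::nat). L - r)"
      using edge[of _ c] r[of c] by (intro sum_mono) (smt (verit) lessThan_iff)
    then show ?thesis by simp
  qed
  have box: "r * (real n - 2)\<^sup>2 \<le> 6 * (L - r) * (real n)\<^sup>2" if "2 \<le> n" for n :: nat
  proof -
    have "r * (real n - 2)\<^sup>2 = (\<Sum>c\<in>{1..<int n - 1} \<times> {1..<int n - 1}. r)"
      using that by (simp add: card_cartesian_product power2_eq_square of_nat_diff nat_diff_distrib)
    also have "\<dots> \<le> (\<Sum>c\<in>{1..<int n - 1} \<times> {1..<int n - 1}. \<Sum>k<6. d c k)"
      by (intro sum_mono r)
    also have "\<dots> \<le> (\<Sum>c\<in>{0..<int n} \<times> {0..<int n}. \<Sum>k<6. d (nbr c k) (opp k))"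
      by (rule sum_box_opposite_ge[OF d])
    also have "\<dots> \<le> (\<Sum>c\<in>{0..<int n} \<times> {0..<int n}. 6 * (L - r))"
      by (intro sum_mono cell)
    also have "\<dots> = 6 * (L - r) * (real n)\<^sup>2"
      by (simp add: card_cartesian_product power2_eq_square)
    finally show ?thesis .
  qed
  \<comment> \<open>The interior fills the box asymptotically, so the boundary effect
    vanishes.\<close>
  have "(\<lambda>n. r * ((real n - 2)\<^sup>2 / (real n)\<^sup>2)) \<longlonglongrightarrow> r * 1"
    by (intro tendsto_mult tendsto_const) real_asymp
  moreover have "eventually (\<lambda>n. r * ((real n - 2)\<^sup>2 / (real n)\<^sup>2) \<le> 6 * (L - r)) sequentially"
    using eventually_ge_at_top[of 2]
  proof eventually_elim
    case (elim n)
    with box[OF elim] show ?case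
      by (simp add: divide_le_eq)
  qed
  ultimately have "r * 1 \<le> 6 * (L - r)"
    by (intro tendsto_upperbound[of _ _ sequentially]) auto
  then show ?thesis by simp
qed

lemma achievable_le:
  assumes ab: "0 < a" "a \<le> b" and P: "0 < P" and r: "cell_rate_achievable a b P r"
  shows "r \<le> 6 / 7 * rate_bound a P"
proof -
  obtain N M enc dec where good: "good_code a b P (1 / 28) N M enc dec"
    and r: "\<And>c. r \<le> (\<Sum>k<6. ln (real (M c k))) / real N"
    using r unfolding cell_rate_achievable_def by (metis zero_less_divide_1_iff zero_less_numeral)
  have N: "0 < N" and M: "\<And>c k. k < 6 \<Longrightarrow> 1 \<le> M c k"
    using good by (auto simp: good_code_def)
  show ?thesis
  proof (rule rate_from_edge_bounds)
    show "0 \<le> ln (real (M c k)) / real N" if "k < 6" for c k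
      using M[OF that, of c] by simp
    show "r \<le> (\<Sum>j<6. ln (real (M c j)) / real N)" for c
      using r[of c] by (simp add: sum_divide_distrib)
    fix c k assume k: "k < (6 :: nat)"
    have pos: "0 < real (M c j)" if "j < 6" for c j
      using M[OF that, of c] by simp
    have S: "0 < 1 + 8 * a\<^sup>2 * P"
      using P by (simp add: add_pos_nonneg)
    have pos': "0 < real (M (nbr c k) (opp k))"
      using M[of "opp k" "nbr c k"] by simp
    have prod: "0 < (\<Prod>j<6. real (M c j))"
      using pos by (intro prod_pos) simp
    have "(\<Sum>j<6. ln (real (M c j))) = ln (\<Prod>j<6. real (M c j))"
      using pos by (intro ln_prod[symmetric]) simp_all
    then have "(\<Sum>j<6. ln (real (M c j))) + ln (real (M (nbr c k) (opp k)))
        = ln ((\<Prod>j<6. real (M c j)) * real (M (nbr c k) (opp k)))"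
      using prod pos' by (simp add: ln_mult_pos)
    also have "\<dots> \<le> ln (4 * (exp 1 * (1 + 8 * a\<^sup>2 * P)) ^ N)"
      using edge_converse[OF good ab P _ k] mult_pos_pos[OF prod pos'] by (intro ln_mono) simp_all
    also have "\<dots> = ln 4 + real N * (1 + ln (1 + 8 * a\<^sup>2 * P))"
      using S by (simp add: ln_mult ln_realpow)
    also have "\<dots> \<le> real N * ln 4 + real N * (1 + ln (1 + 8 * a\<^sup>2 * P))"
      using N by (simp add: mult_le_cancel_right1)
    also have "\<dots> = real N * rate_bound a P"
      by (simp add: rate_bound_def algebra_simps)
    finally show "(\<Sum>j<6. ln (real (M c j)) / real N) + ln (real (M (nbr c k) (opp k))) / real N \<le> rate_bound a P"
      using N by (simp add: field_simps flip: sum_divide_distrib)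
  qed
qed

section \<open>Codes and noise tails\<close>

definition hamming :: "nat \<Rightarrow> (nat \<Rightarrow> 'a) \<Rightarrow> (nat \<Rightarrow> 'a) \<Rightarrow> nat" where
  "hamming L x y = card {i \<in> {..<L}. x i \<noteq> y i}"

text \<open>A word of the ball is determined by the set of positions where it leaves
  \<open>y\<close> and its letters there. Admitting all \<open>2 ^ L\<close> sets costs only
  \<open>ln 2\<close> per symbol, which is negligible against \<open>ln P\<close>.\<close>

lemma card_hamming_ball_le:
  assumes A: "finite A" "A \<noteq> {}"
  shows "card {x \<in> {..<L} \<rightarrow>\<^sub>E A. hamming L x y \<le> \<rho>} \<le> 2 ^ L * card A ^ \<rho>"
proof -
  let ?T = "{T \<in> Pow {..<L}. card T \<le> \<rho>}"
  \<comment> \<open>The value \<open>undefined\<close> beyond \<open>L\<close> is the default of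
    extensional functions, needed for equality with \<open>x\<close>.\<close>
  let ?f = "\<lambda>T g i. if i \<in> T then g i else if i < L then y i else undefined"
  have cover: "{x \<in> {..<L} \<rightarrow>\<^sub>E A. hamming L x y \<le> \<rho>} \<subseteq> (\<Union>T\<in>?T. ?f T ` (T \<rightarrow>\<^sub>E A))"
  proof
    fix x assume x: "x \<in> {x \<in> {..<L} \<rightarrow>\<^sub>E A. hamming L x y \<le> \<rho>}"
    let ?D = "{i \<in> {..<L}. x i \<noteq> y i}"
    have "?D \<in> ?T"
      using x by (auto simp: hamming_def)
    moreover have "x = ?f ?D (restrict x ?D)" "restrict x ?D \<in> ?D \<rightarrow>\<^sub>E A"
      using x by (auto simp: PiE_iff extensional_def)
    ultimately show "x \<in> (\<Union>T\<in>?T. ?f T ` (T \<rightarrow>\<^sub>E A))"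
      by blast
  qed
  have fin: "finite T" if "T \<in> ?T" for T
    using that finite_subset by auto
  have "card {x \<in> {..<L} \<rightarrow>\<^sub>E A. hamming L x y \<le> \<rho>} \<le> card (\<Union>T\<in>?T. ?f T ` (T \<rightarrow>\<^sub>E A))"
    using A by (intro card_mono[OF _ cover] finite_UN_I finite_imageI finite_PiE fin) simp_all
  also have "\<dots> \<le> (\<Sum>T\<in>?T. card (?f T ` (T \<rightarrow>\<^sub>E A)))"
    by (intro card_UN_le) auto
  also have "\<dots> \<le> (\<Sum>T\<in>?T. card A ^ \<rho>)"
  proof (intro sum_mono)
    fix T assume T: "T \<in> ?T"
    have "card (?f T ` (T \<rightarrow>\<^sub>E A)) \<le> card (T \<rightarrow>\<^sub>E A)"
      using fin[OF T] A by (intro card_image_le finite_PiE) auto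
    also have "\<dots> = card A ^ card T"
      using fin[OF T] by (simp add: card_PiE)
    also have "\<dots> \<le> card A ^ \<rho>"
      using T A by (intro power_increasing) (auto simp: Suc_le_eq card_gt_0_iff)
    finally show "card (?f T ` (T \<rightarrow>\<^sub>E A)) \<le> card A ^ \<rho>" .
  qed
  also have "\<dots> = card ?T * card A ^ \<rho>"
    by simp
  also have "card ?T \<le> card (Pow {..<L})"
    by (intro card_mono) auto
  finally show ?thesis
    by (simp add: card_Pow)
qed

text \<open>Take a maximal code of distance above \<open>\<rho>\<close>. Its balls of radius
  \<open>\<rho>\<close> cover all words, as an uncovered word could be added.\<close>

lemma gilbert_varshamov:
  assumes A: "finite A" "A \<noteq> {}"
  obtains C where "C \<subseteq> {..<L} \<rightarrow>\<^sub>E A"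
    and "\<And>x y. x \<in> C \<Longrightarrow> y \<in> C \<Longrightarrow> x \<noteq> y \<Longrightarrow> \<rho> < hamming L x y"
    and "card A ^ L \<le> card C * (2 ^ L * card A ^ \<rho>)"
proof -
  let ?X = "{..<L} \<rightarrow>\<^sub>E A"
  let ?F = "{C \<in> Pow ?X. \<forall>x\<in>C. \<forall>y\<in>C. x \<noteq> y \<longrightarrow> \<rho> < hamming L x y}"
  have X: "finite ?X"
    using A by (intro finite_PiE) auto
  then have "finite ?F" "{} \<in> ?F"
    by auto
  then obtain C where C: "C \<in> ?F" and max: "\<And>C'. C' \<in> ?F \<Longrightarrow> C \<subseteq> C' \<Longrightarrow> C' = C"
    by (metis (no_types, lifting) finite_has_maximal empty_iff)
  have comm: "hamming L x y = hamming L y x" for x y :: "nat \<Rightarrow> 'a"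
    by (auto simp: hamming_def intro!: arg_cong[where f = card])
  have "?X \<subseteq> (\<Union>y\<in>C. {x \<in> ?X. hamming L x y \<le> \<rho>})"
  proof
    fix x assume x: "x \<in> ?X"
    show "x \<in> (\<Union>y\<in>C. {x \<in> ?X. hamming L x y \<le> \<rho>})"
    proof (rule ccontr)
      assume "x \<notin> (\<Union>y\<in>C. {x \<in> ?X. hamming L x y \<le> \<rho>})"
      with x have far: "\<forall>y\<in>C. \<rho> < hamming L x y"
        by (auto simp: not_le)
      then have "\<forall>y\<in>C. \<rho> < hamming L x y \<and> \<rho> < hamming L y x"
        using comm[of x] by metis
      moreover have "insert x C \<subseteq> ?X"
        using C x by simp
      moreover have "\<rho> < hamming L u v" if "u \<in> C" "v \<in> C" "u \<noteq> v" for u v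
        using C that by simp
      ultimately have "\<rho> < hamming L u v" if "u \<in> insert x C" "v \<in> insert x C" "u \<noteq> v" for u v
        using that by (elim insertE) simp_all
      with \<open>insert x C \<subseteq> ?X\<close> have "insert x C \<in> ?F"
        by simp
      then have "insert x C = C"
        by (rule max) (rule subset_insertI)
      then have "x \<in> C"
        by (metis insertI1)
      with far have "\<rho> < hamming L x x"
        by blast
      then show False
        by (simp add: hamming_def)
    qed
  qed
  moreover have finC: "finite C"
    using C X finite_subset by auto
  ultimately have "card ?X \<le> card (\<Union>y\<in>C. {x \<in> ?X. hamming L x y \<le> \<rho>})"
    using X by (intro card_mono finite_UN_I) auto
  also have "\<dots> \<le> (\<Sum>y\<in>C. card {x \<in> ?X. hamming L x y \<le> \<rho>})"
    using finC by (rule card_UN_le)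
  also have "\<dots> \<le> (\<Sum>y\<in>C. 2 ^ L * card A ^ \<rho>)"
    by (intro sum_mono card_hamming_ball_le A)
  finally have "card A ^ L \<le> card C * (2 ^ L * card A ^ \<rho>)"
    by (simp add: card_PiE)
  with C show ?thesis
    by (intro that[of C]) auto
qed

text \<open>Continuity from above: the complements of growing discs decrease to the empty
  set.\<close>

lemma cgauss_tail:
  assumes "0 < p"
  obtains \<tau> where "0 < \<tau>" "measure cgauss {z. \<tau> \<le> cmod z} \<le> p"
proof -
  interpret prob_space cgauss
    by (rule prob_space_cgauss)
  have "(\<lambda>n. measure cgauss {z. real n \<le> cmod z}) \<longlonglongrightarrow> measure cgauss (\<Inter>n. {z. real n \<le> cmod z})"
    by (intro finite_Lim_measure_decseq) (auto simp: decseq_def)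
  moreover have "(\<Inter>n. {z. real n \<le> cmod z}) = {}"
    using reals_Archimedean2[of "cmod z" for z] by (auto simp: not_le[symmetric])
  ultimately have "(\<lambda>n. measure cgauss {z. real n \<le> cmod z}) \<longlonglongrightarrow> 0"
    by simp
  then have "eventually (\<lambda>n. measure cgauss {z. real n \<le> cmod z} < p) sequentially"
    using assms by (rule order_tendstoD)
  then have "eventually (\<lambda>n. 0 < n \<and> measure cgauss {z. real n \<le> cmod z} < p) sequentially"
    using eventually_gt_at_top[of 0] by eventually_elim simp
  then obtain n where "0 < n" "measure cgauss {z. real n \<le> cmod z} < p"
    using eventually_happens'[OF sequentially_bot] by blast
  then show ?thesis
    by (intro that[of "real n"]) simp_all
qed

text \<open>More than \<open>t\<close> large samples include a set of exactly \<open>t + 1\<close>.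
  Independence gives each such set the product probability, and \<open>2 ^ card J\<close> bounds the
  number of sets.\<close>

lemma measure_noise_many_large_le:
  assumes J: "J \<subseteq> {..<N}"
  shows "measure (noise N) {z \<in> space (noise N). t < card {n \<in> J. \<tau> \<le> cmod (z n)}}
    \<le> 2 ^ card J * measure cgauss {z. \<tau> \<le> cmod z} ^ Suc t"
proof -
  interpret C: product_prob_space "\<lambda>_. cgauss" "{..<N}"
    using prob_space_cgauss
    by (simp add: product_prob_space_def product_prob_space_axioms_def product_sigma_finite_def
        prob_space_imp_sigma_finite)
  interpret noise: prob_space "noise N"
    by (rule prob_space_noise)
  let ?p = "measure cgauss {z. \<tau> \<le> cmod z}"
  let ?T = "{T \<in> Pow J. card T = Suc t}"
  define B where "B T = (\<Pi>\<^sub>E n\<in>{..<N}. if n \<in> T then {z. \<tau> \<le> cmod z} else UNIV)" for T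
  have finJ: "finite J"
    using J finite_subset by auto
  have B: "B T \<in> sets (noise N)" for T
    unfolding B_def noise_def by (intro sets_PiM_I_finite) auto
  have mB: "measure (noise N) (B T) = ?p ^ Suc t" if "T \<in> ?T" for T
  proof -
    have "measure (noise N) (B T) = (\<Prod>n<N. measure cgauss (if n \<in> T then {z. \<tau> \<le> cmod z} else UNIV))"
      unfolding B_def noise_def by (subst C.measure_PiM_emb[symmetric]) (auto simp: prod_emb_id)
    also have "\<dots> = (\<Prod>n<N. if n \<in> T then ?p else 1)"
      using prob_space.prob_space[OF prob_space_cgauss] by (intro prod.cong) auto
    also have "\<dots> = ?p ^ card ({..<N} \<inter> T)"
      by (simp add: prod.If_cases)
    also have "{..<N} \<inter> T = T"
      using that J by auto
    finally show ?thesis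
      using that by simp
  qed
  have "{z \<in> space (noise N). t < card {n \<in> J. \<tau> \<le> cmod (z n)}} \<subseteq> (\<Union>T\<in>?T. B T)"
  proof
    fix z assume z: "z \<in> {z \<in> space (noise N). t < card {n \<in> J. \<tau> \<le> cmod (z n)}}"
    then have "Suc t \<le> card {n \<in> J. \<tau> \<le> cmod (z n)}"
      by simp
    then obtain T where T: "T \<subseteq> {n \<in> J. \<tau> \<le> cmod (z n)}" "card T = Suc t"
      by (rule obtain_subset_with_card_n)
    show "z \<in> (\<Union>T\<in>?T. B T)"
    proof (rule UN_I)
      show "T \<in> ?T"
        using T by blast
      show "z \<in> B T"
        using T z unfolding B_def space_noise PiE_iff by auto
    qed
  qed
  then have "measure (noise N) {z \<in> space (noise N). t < card {n \<in> J. \<tau> \<le> cmod (z n)}}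
      \<le> measure (noise N) (\<Union>T\<in>?T. B T)"
    using finJ B by (intro noise.finite_measure_mono) auto
  also have "\<dots> \<le> (\<Sum>T\<in>?T. measure (noise N) (B T))"
    using finJ B by (intro measure_UNION_le) auto
  also have "\<dots> = real (card ?T) * ?p ^ Suc t"
    by (simp add: mB)
  also have "\<dots> \<le> real (card (Pow J)) * ?p ^ Suc t"
    using finJ by (intro mult_right_mono of_nat_mono card_mono) auto
  finally show ?thesis
    using finJ by (simp add: card_Pow)
qed

section \<open>Time division over the seven colours\<close>

text \<open>The colour classes are the translates of a perfect code: the six directions have the six
  nonzero values of \<open>x + 3 y\<close> modulo 7.\<close>
definition colour :: "cell \<Rightarrow> nat" where
  "colour c = nat ((fst c + 3 * snd c) mod 7)"

lemma colour_less [simp]: "colour c < 7"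
  by (simp add: colour_def nat_less_iff)

lemma colour_eq_iff: "colour c = colour d \<longleftrightarrow> 7 dvd (fst c + 3 * snd c) - (fst d + 3 * snd d)"
  by (simp add: colour_def eq_nat_nat_iff mod_eq_dvd_iff)

lemma colour_nbr_neq: "k < 6 \<Longrightarrow> colour (nbr c k) \<noteq> colour c"
  unfolding colour_eq_iff by (erule less_6_cases) (simp_all add: nbr_def hex_dir_def)

lemma colour_nbr_inj:
  assumes "j < 6" "k < 6" "colour (nbr c j) = colour (nbr c k)"
  shows "j = k"
  using assms unfolding colour_eq_iff
  by (elim less_6_cases) (simp_all add: nbr_def hex_dir_def)

text \<open>Slot \<open>n\<close> silences the colour \<open>n mod 7\<close>, so this is the
  direction of the silent neighbour, unique by \<open>colour_nbr_inj\<close>. It is unspecified when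
  \<open>c\<close> itself is silent.\<close>

definition slot_dir :: "cell \<Rightarrow> nat \<Rightarrow> nat" where
  "slot_dir c n = (THE k. k < 6 \<and> colour (nbr c k) = n mod 7)"

lemma slot_dir_eq:
  assumes "k < 6" "colour (nbr c k) = n mod 7"
  shows "slot_dir c n = k"
  unfolding slot_dir_def
proof (rule the_equality)
  show "k < 6 \<and> colour (nbr c k) = n mod 7"
    using assms by blast
  show "j = k" if "j < 6 \<and> colour (nbr c j) = n mod 7" for j
    using that assms by (intro colour_nbr_inj[of j k c]) simp_all
qed

text \<open>Slots come in groups of seven. Group \<open>i\<close> carries symbol \<open>i\<close> of
  all six users' codewords, one per slot, and one slot of silence.\<close>

definition tdma_enc :: "(nat \<Rightarrow> nat \<Rightarrow> complex) \<Rightarrow> cell \<Rightarrow> (nat \<Rightarrow> nat) \<Rightarrow> nat \<Rightarrow> complex" where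
  "tdma_enc cw c w n = (if colour c = n mod 7 then 0 else cw (w (slot_dir c n)) (n div 7))"

text \<open>Bounded-distance decoding on the slots where the interfering neighbour is silent: a
  message is accepted when at most \<open>t\<close> residuals reach \<open>\<tau>\<close>.
  \<open>LEAST\<close> merely fixes a choice; \<open>tdma_dec_correct\<close> shows
  uniqueness.\<close>

definition tdma_dec :: "nat \<Rightarrow> nat \<Rightarrow> nat \<Rightarrow> real \<Rightarrow> (nat \<Rightarrow> nat \<Rightarrow> complex) \<Rightarrow>
    cell \<Rightarrow> nat \<Rightarrow> (nat \<Rightarrow> complex) \<Rightarrow> (nat \<Rightarrow> complex) \<Rightarrow> (nat \<Rightarrow> complex) \<Rightarrow> nat" where
  "tdma_dec L M t \<tau> cw c k h1 h2 y = (LEAST m. m < M \<and>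
    card {n \<in> {n \<in> {..<7 * L}. n mod 7 = colour (nbr c k)}. \<tau> \<le> cmod (y n - h1 n * cw m (n div 7))} \<le> t)"

lemma slots_image:
  assumes "ph < (7 :: nat)"
  shows "{n \<in> {..<7 * L}. n mod 7 = ph} = (\<lambda>i. 7 * i + ph) ` {..<L}"
proof
  show "{n \<in> {..<7 * L}. n mod 7 = ph} \<subseteq> (\<lambda>i. 7 * i + ph) ` {..<L}"
  proof
    fix n assume "n \<in> {n \<in> {..<7 * L}. n mod 7 = ph}"
    then have "n = 7 * (n div 7) + ph" "n div 7 < L"
      by auto
    then show "n \<in> (\<lambda>i. 7 * i + ph) ` {..<L}"
      by auto
  qed
  show "(\<lambda>i. 7 * i + ph) ` {..<L} \<subseteq> {n \<in> {..<7 * L}. n mod 7 = ph}"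
    using assms by auto
qed

lemma tdma_dec_measurable:
  "tdma_dec L M t \<tau> cw c k h1 h2 \<in> measurable (Pi\<^sub>M {..<7 * L} (\<lambda>_. borel)) (count_space UNIV)"
proof -
  let ?J = "{n \<in> {..<7 * L}. n mod 7 = colour (nbr c k)}"
  have "Measurable.pred (Pi\<^sub>M {..<7 * L} (\<lambda>_. borel))
      (\<lambda>y. n \<in> ?J \<and> \<tau> \<le> cmod (y n - h1 n * cw m (n div 7)))" for n m
  proof (cases "n \<in> ?J")
    case True
    then have [measurable]: "(\<lambda>y. y n) \<in> measurable (Pi\<^sub>M {..<7 * L} (\<lambda>_. borel)) borel"
      by (intro measurable_component_singleton) auto
    show ?thesis by measurable
  next
    case False
    then show ?thesis by simp
  qed
  then have [measurable]: "(\<lambda>y. card {n \<in> ?J. \<tau> \<le> cmod (y n - h1 n * cw m (n div 7))})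
      \<in> measurable (Pi\<^sub>M {..<7 * L} (\<lambda>_. borel)) (count_space UNIV)" for m
    by (intro measurable_card) (simp add: pred_def)
  show ?thesis
    unfolding tdma_dec_def[abs_def] by measurable
qed

text \<open>Where two codewords differ, the channel leaves a gap of at least
  \<open>2 * \<tau>\<close>, so by the triangle inequality the residual of one of them reaches
  \<open>\<tau>\<close>. Two accepted messages would thus differ in at most \<open>2 * t\<close>
  positions, against the distance of the code.\<close>

lemma tdma_dec_correct:
  assumes a: "0 < a" and h: "\<And>n. a \<le> cmod (h1 n)" and k: "k < 6" and m: "m < M"
    and dist: "\<And>m m'. m < M \<Longrightarrow> m' < M \<Longrightarrow> m \<noteq> m' \<Longrightarrow> 2 * t < hamming L (cw m) (cw m')"
    and sep: "\<And>m m' i. m < M \<Longrightarrow> m' < M \<Longrightarrow> i < L \<Longrightarrow> cw m i \<noteq> cw m' i \<Longrightarrow> 2 * \<tau> / a \<le> cmod (cw m i - cw m' i)"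
    and y: "\<And>n. n < 7 * L \<Longrightarrow> n mod 7 = colour (nbr c k) \<Longrightarrow> y n = h1 n * cw m (n div 7) + z n"
    and z: "card {n \<in> {n \<in> {..<7 * L}. n mod 7 = colour (nbr c k)}. \<tau> \<le> cmod (z n)} \<le> t"
  shows "tdma_dec L M t \<tau> cw c k h1 h2 y = m"
proof -
  define J where "J = {n \<in> {..<7 * L}. n mod 7 = colour (nbr c k)}"
  define bad where "bad m = {n \<in> J. \<tau> \<le> cmod (y n - h1 n * cw m (n div 7))}" for m
  have "bad m = {n \<in> J. \<tau> \<le> cmod (z n)}"
    using y by (auto simp: bad_def J_def)
  then have bad: "card (bad m) \<le> t"
    using z by (simp add: J_def)
  have fin: "finite (bad m)" for m
    by (simp add: bad_def J_def)
  have unique: "m' = m" if m': "m' < M" and bad': "card (bad m') \<le> t" for m'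
  proof (rule ccontr)
    assume neq: "m' \<noteq> m"
    have "{i \<in> {..<L}. cw m i \<noteq> cw m' i} \<subseteq> (\<lambda>n. n div 7) ` (bad m \<union> bad m')"
    proof
      fix i assume i: "i \<in> {i \<in> {..<L}. cw m i \<noteq> cw m' i}"
      let ?n = "7 * i + colour (nbr c k)"
      have "i < L"
        using i by simp
      then have "?n < 7 * L"
        using colour_less[of "nbr c k"] by linarith
      then have n: "?n \<in> J" "?n div 7 = i"
        by (simp_all add: J_def)
      have "?n \<in> bad m \<union> bad m'"
      proof (rule ccontr)
        assume "?n \<notin> bad m \<union> bad m'"
        then have lt: "cmod (y ?n - h1 ?n * cw m i) < \<tau>" "cmod (y ?n - h1 ?n * cw m' i) < \<tau>"
          using n by (auto simp: bad_def)
        have "a * (2 * \<tau> / a) \<le> a * cmod (cw m i - cw m' i)"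
          using a sep[of m m' i] m m' i by (intro mult_left_mono) auto
        also have "\<dots> \<le> cmod (h1 ?n) * cmod (cw m i - cw m' i)"
          using h by (intro mult_right_mono) auto
        also have "\<dots> = cmod ((y ?n - h1 ?n * cw m' i) - (y ?n - h1 ?n * cw m i))"
          by (simp add: algebra_simps flip: norm_mult)
        also have "\<dots> \<le> cmod (y ?n - h1 ?n * cw m' i) + cmod (y ?n - h1 ?n * cw m i)"
          by (rule norm_triangle_ineq4)
        finally show False
          using a lt by simp
      qed
      then show "i \<in> (\<lambda>n. n div 7) ` (bad m \<union> bad m')"
        using n(2) by (intro image_eqI[of _ _ ?n]) auto
    qed
    then have "hamming L (cw m) (cw m') \<le> card ((\<lambda>n. n div 7) ` (bad m \<union> bad m'))"
      unfolding hamming_def using fin by (intro card_mono) auto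
    also have "\<dots> \<le> card (bad m \<union> bad m')"
      using fin by (intro card_image_le) auto
    also have "\<dots> \<le> card (bad m) + card (bad m')"
      by (rule card_Un_le)
    finally show False
      using dist[OF m m'] neq bad bad' by simp
  qed
  have "(LEAST m. m < M \<and> card (bad m) \<le> t) = m"
    using unique m bad by (metis (mono_tags, lifting) LeastI)
  then show ?thesis
    by (simp add: tdma_dec_def bad_def J_def)
qed

section \<open>Power and error probability of the time-division code\<close>

lemma average_le:
  fixes f :: "'a \<Rightarrow> 'b \<Rightarrow> real"
  assumes "0 \<le> C" "\<And>x y. x \<in> A \<Longrightarrow> y \<in> B \<Longrightarrow> f x y \<le> C"
  shows "(\<Sum>x\<in>A. \<Sum>y\<in>B. f x y) / real (card A * card B) \<le> C"
proof (cases "card A * card B = 0")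
  \<comment> \<open>Division by zero yields 0, so nonnegativity of \<open>C\<close> settles the
    empty case.\<close>
  case True
  show ?thesis using assms(1) unfolding True by simp
next
  case False
  have "(\<Sum>x\<in>A. \<Sum>y\<in>B. f x y) \<le> (\<Sum>x\<in>A. \<Sum>y\<in>B. C)"
    using assms(2) by (intro sum_mono)
  also have "\<dots> = C * real (card A * card B)"
    by simp
  finally show ?thesis
    using False by (simp add: divide_le_eq)
qed

text \<open>In the slots of colour \<open>colour (nbr c k)\<close> the neighbour is silent and
  \<open>c\<close> sends the codeword of user \<open>k\<close>, so user \<open>k\<close> has an
  interference-free channel of \<open>L\<close> uses. It can err only if more than \<open>t\<close>
  noise samples there are large.\<close>

lemma tdma_good_code:
  assumes a: "0 < a" and L: "0 < L" and M: "1 \<le> M" and P: "0 \<le> P"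
    and dist: "\<And>m m'. m < M \<Longrightarrow> m' < M \<Longrightarrow> m \<noteq> m' \<Longrightarrow> 2 * t < hamming L (cw m) (cw m')"
    and sep: "\<And>m m' i. m < M \<Longrightarrow> m' < M \<Longrightarrow> i < L \<Longrightarrow> cw m i \<noteq> cw m' i \<Longrightarrow> 2 * \<tau> / a \<le> cmod (cw m i - cw m' i)"
    and power: "\<And>m i. m < M \<Longrightarrow> i < L \<Longrightarrow> (cmod (cw m i))\<^sup>2 \<le> P"
    and eps: "2 ^ L * measure cgauss {z. \<tau> \<le> cmod z} ^ Suc t \<le> eps"
  shows "good_code a b P eps (7 * L) (\<lambda>_ _. M) (tdma_enc cw) (tdma_dec L M t \<tau> cw)"
  unfolding good_code_def
proof (intro conjI allI impI)
  show "0 < 7 * L" "1 \<le> M"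
    using L M by auto
  let ?M = "\<lambda>(_ :: cell) (_ :: nat). M"
  show "tdma_dec L M t \<tau> cw c k h1 h2 \<in> measurable (Pi\<^sub>M {..<7 * L} (\<lambda>_. borel)) (count_space UNIV)"
    for c k h1 h2
    by (rule tdma_dec_measurable)
  \<comment> \<open>By counting: six distinct neighbour colours, all different from the own one,
    exhaust the other six.\<close>
  have ex_dir: "\<exists>k<6. colour (nbr c k) = ph" if "ph < 7" "ph \<noteq> colour c" for c ph
  proof -
    have "(\<lambda>k. colour (nbr c k)) ` {..<6} = {..<7} - {colour c}"
    proof (rule card_subset_eq)
      show "card ((\<lambda>k. colour (nbr c k)) ` {..<6}) = card ({..<7} - {colour c})"
        using colour_nbr_inj by (subst card_image) (auto simp: inj_on_def)
    qed (use colour_nbr_neq[of _ c] in auto)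
    with that have "ph \<in> (\<lambda>k. colour (nbr c k)) ` {..<6}"
      by simp
    then show ?thesis
      by blast
  qed
  show "(\<Sum>w\<in>msg_space ?M c. \<Sum>n<7 * L. (cmod (tdma_enc cw c w n))\<^sup>2)
      / real (card (msg_space ?M c) * (7 * L)) \<le> P" for c
  proof -
    have "(cmod (tdma_enc cw c w n))\<^sup>2 \<le> P" if w: "w \<in> msg_space ?M c" and n: "n \<in> {..<7 * L}" for w n
    proof (cases "colour c = n mod 7")
      case True
      then show ?thesis using P by (simp add: tdma_enc_def)
    next
      case False
      then obtain k where k: "k < 6" "colour (nbr c k) = n mod 7"
        using ex_dir[of "n mod 7" c] by auto
      then have "w (slot_dir c n) < M" "n div 7 < L"
        using w n by (auto simp: slot_dir_eq msg_space_def PiE_iff)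
      with False show ?thesis
        by (simp add: tdma_enc_def power)
    qed
    then show ?thesis
      using average_le[OF P, of "msg_space ?M c" "{..<7 * L}" "\<lambda>w n. (cmod (tdma_enc cw c w n))\<^sup>2"]
      by (simp only: card_lessThan)
  qed
  fix c k h1 h2
  assume k: "k < (6 :: nat)" and h1: "admissible a b h1"
  let ?J = "{n \<in> {..<7 * L}. n mod 7 = colour (nbr c k)}"
  interpret noise: prob_space "noise (7 * L)"
    by (rule prob_space_noise)
  have "card ?J = L"
    by (subst slots_image) (auto simp: card_image inj_on_def)
  with eps have "2 ^ card ?J * measure cgauss {z. \<tau> \<le> cmod z} ^ Suc t \<le> eps"
    by (simp only:)
  moreover have "?J \<subseteq> {..<7 * L}"
    by blast
  ultimately have many: "measure (noise (7 * L)) {z \<in> space (noise (7 * L)). t < card {n \<in> ?J. \<tau> \<le> cmod (z n)}} \<le> eps"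
    by (intro order_trans[OF measure_noise_many_large_le])
  have many_sets: "{z \<in> space (noise (7 * L)). t < card {n \<in> ?J. \<tau> \<le> cmod (z n)}} \<in> sets (noise (7 * L))"
  proof -
    have "Measurable.pred (noise (7 * L)) (\<lambda>z. n \<in> ?J \<and> \<tau> \<le> cmod (z n))" for n
    proof (cases "n \<in> ?J")
      case True
      then have "(\<lambda>z. z n) \<in> measurable (Pi\<^sub>M {..<7 * L} (\<lambda>_. borel)) borel"
        by (intro measurable_component_singleton) auto
      then have [measurable]: "(\<lambda>z. z n) \<in> borel_measurable (noise (7 * L))"
        by (simp add: measurable_cong_sets[OF sets_noise refl])
      show ?thesis by measurable
    next
      case False
      then show ?thesis by simp
    qed
    then have [measurable]: "(\<lambda>z. card {n \<in> ?J. \<tau> \<le> cmod (z n)}) \<in> measurable (noise (7 * L)) (count_space UNIV)"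
      by (intro measurable_card) (simp add: pred_def)
    show ?thesis by measurable
  qed
  show "err_prob (7 * L) ?M (tdma_enc cw) (tdma_dec L M t \<tau> cw) h1 h2 c k \<le> eps"
    unfolding err_prob_def
  proof (rule average_le)
    show "0 \<le> eps"
      using many by (meson measure_nonneg order_trans)
    fix w1 w2 assume w1: "w1 \<in> msg_space ?M c" and "w2 \<in> msg_space ?M (nbr c k)"
    have "{z \<in> space (noise (7 * L)). tdma_dec L M t \<tau> cw c k h1 h2
          (rx (7 * L) h1 h2 (tdma_enc cw c w1) (tdma_enc cw (nbr c k) w2) z) \<noteq> w1 k}
      \<subseteq> {z \<in> space (noise (7 * L)). t < card {n \<in> ?J. \<tau> \<le> cmod (z n)}}"
    proof safe
      fix z
      assume neq: "tdma_dec L M t \<tau> cw c k h1 h2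
          (rx (7 * L) h1 h2 (tdma_enc cw c w1) (tdma_enc cw (nbr c k) w2) z) \<noteq> w1 k"
      show "t < card {n \<in> ?J. \<tau> \<le> cmod (z n)}"
      proof (rule ccontr)
        assume "\<not> t < card {n \<in> ?J. \<tau> \<le> cmod (z n)}"
        then have few: "card {n \<in> ?J. \<tau> \<le> cmod (z n)} \<le> t"
          by simp
        have w1k: "w1 k < M"
          using w1 k by (auto simp: msg_space_def PiE_iff)
        have y: "rx (7 * L) h1 h2 (tdma_enc cw c w1) (tdma_enc cw (nbr c k) w2) z n
            = h1 n * cw (w1 k) (n div 7) + z n" if "n < 7 * L" "n mod 7 = colour (nbr c k)" for n
          using that slot_dir_eq[OF k, of c n] colour_nbr_neq[OF k, of c]
          by (simp add: rx_def tdma_enc_def)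
        have h1_ge: "a \<le> cmod (h1 n)" for n
          using h1 by (simp add: admissible_def)
        have "tdma_dec L M t \<tau> cw c k h1 h2
            (rx (7 * L) h1 h2 (tdma_enc cw c w1) (tdma_enc cw (nbr c k) w2) z) = w1 k"
          by (rule tdma_dec_correct[where a = a and M = M and z = z])
            (fact a h1_ge k w1k dist sep y few)+
        with neq show False
          by contradiction
      qed
    qed
    then show "measure (noise (7 * L)) {z \<in> space (noise (7 * L)). tdma_dec L M t \<tau> cw c k h1 h2
          (rx (7 * L) h1 h2 (tdma_enc cw c w1) (tdma_enc cw (nbr c k) w2) z) \<noteq> w1 k} \<le> eps"
      by (rule order_trans[OF noise.finite_measure_mono[OF _ many_sets] many])
  qed
qed

section \<open>The limit\<close>

text \<open>A square QAM constellation. The spacing \<open>s\<close> governs symbol errors and stays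
  fixed, while the size \<open>m\<close> absorbs the power.\<close>

definition grid :: "real \<Rightarrow> nat \<Rightarrow> complex set" where
  "grid s m = (\<lambda>(i, j). Complex (s * real i) (s * real j)) ` ({..<m} \<times> {..<m})"

lemma finite_grid [simp]: "finite (grid s m)"
  by (simp add: grid_def)

lemma card_grid: "s \<noteq> 0 \<Longrightarrow> card (grid s m) = m\<^sup>2"
  unfolding grid_def by (subst card_image) (auto simp: inj_on_def power2_eq_square)

lemma grid_norm_le:
  assumes "0 \<le> s" "x \<in> grid s m"
  shows "(cmod x)\<^sup>2 \<le> 2 * s\<^sup>2 * (real m)\<^sup>2"
proof -
  obtain i j where ij: "i < m" "j < m" "x = Complex (s * real i) (s * real j)"
    using assms by (auto simp: grid_def)
  have "(s * real i)\<^sup>2 \<le> (s * real m)\<^sup>2" "(s * real j)\<^sup>2 \<le> (s * real m)\<^sup>2"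
    using ij assms by (auto intro!: power_mono mult_left_mono)
  with ij show ?thesis
    by (simp add: cmod_power2 power_mult_distrib)
qed

lemma grid_separated:
  assumes "0 \<le> s" "x \<in> grid s m" "y \<in> grid s m" "x \<noteq> y"
  shows "s \<le> cmod (x - y)"
proof -
  obtain i j k l where x: "x = Complex (s * real i) (s * real j)" and y: "y = Complex (s * real k) (s * real l)"
    using assms by (auto simp: grid_def)
  have far: "s \<le> \<bar>s * real u - s * real v\<bar>" if "u \<noteq> v" for u v :: nat
  proof -
    have "1 \<le> \<bar>real u - real v\<bar>"
      using that by linarith
    then have "s * 1 \<le> s * \<bar>real u - real v\<bar>"
      using assms by (intro mult_left_mono)
    also have "\<dots> = \<bar>s * real u - s * real v\<bar>"
      using assms by (simp add: abs_mult flip: right_diff_distrib)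
    finally show ?thesis by simp
  qed
  have "i \<noteq> k \<or> j \<noteq> l"
    using x y assms by auto
  then show ?thesis
  proof
    assume "i \<noteq> k"
    from far[OF this] show ?thesis
      using abs_Re_le_cmod[of "x - y"] by (simp add: x y)
  next
    assume "j \<noteq> l"
    from far[OF this] show ?thesis
      using abs_Im_le_cmod[of "x - y"] by (simp add: x y)
  qed
qed

text \<open>\<open>K\<close> trades rate for reliability: the outer code corrects \<open>t\<close>
  errors among \<open>2 * K * t\<close> symbols at the price of a fraction \<open>1 / K\<close> of
  the rate. Under \<open>tail\<close>, the failure probability vanishes geometrically in
  \<open>t\<close> at fixed power.\<close>

lemma tdma_achievable:
  assumes a: "0 < a" and \<tau>: "0 < \<tau>" and K: "1 \<le> K" and m: "1 \<le> m"
    and tail: "4 ^ K * measure cgauss {z. \<tau> \<le> cmod z} < 1"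
    and P: "2 * (2 * \<tau> / a)\<^sup>2 * (real m)\<^sup>2 \<le> P"
  shows "cell_rate_achievable a b P (6 / 7 * ((1 - 1 / real K) * (2 * ln (real m)) - ln 2))"
  unfolding cell_rate_achievable_def
proof (intro allI impI)
  fix eps :: real assume "0 < eps"
  let ?p = "measure cgauss {z. \<tau> \<le> cmod z}"
  interpret prob_space cgauss
    by (rule prob_space_cgauss)
  define s where "s = 2 * \<tau> / a"
  have s: "0 < s"
    using a \<tau> by (simp add: s_def)
  have "(\<lambda>t. (4 ^ K * ?p) ^ t) \<longlonglongrightarrow> 0"
    using tail by (intro LIMSEQ_power_zero) simp
  then have "eventually (\<lambda>t. (4 ^ K * ?p) ^ t < eps) sequentially"
    using \<open>0 < eps\<close> by (rule order_tendstoD)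
  then have "eventually (\<lambda>t. 0 < t \<and> (4 ^ K * ?p) ^ t < eps) sequentially"
    using eventually_gt_at_top[of 0] by eventually_elim simp
  then obtain t where t: "0 < t" and eps: "(4 ^ K * ?p) ^ t < eps"
    using eventually_happens'[OF sequentially_bot] by blast
  \<comment> \<open>With this length \<open>2 ^ L = (4 ^ K) ^ t\<close>, matching
    \<open>tail\<close>, and the distance \<open>2 * t\<close> is the fraction \<open>1 / K\<close>
    of \<open>L\<close>.\<close>
  define L where "L = 2 * K * t"
  have L: "0 < L"
    using K t by (simp add: L_def)
  let ?A = "grid s m"
  have card_A: "card ?A = m\<^sup>2"
    using s by (simp add: card_grid)
  then have "?A \<noteq> {}"
    using m by auto
  then obtain C where C: "C \<subseteq> {..<L} \<rightarrow>\<^sub>E ?A"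
    and dist: "\<And>x y. x \<in> C \<Longrightarrow> y \<in> C \<Longrightarrow> x \<noteq> y \<Longrightarrow> 2 * t < hamming L x y"
    and size: "card ?A ^ L \<le> card C * (2 ^ L * card ?A ^ (2 * t))"
    using gilbert_varshamov[OF finite_grid, of s m L "2 * t"] by metis
  have "finite C"
    using C by (rule finite_subset) (auto intro!: finite_PiE)
  define M where "M = card C"
  have "0 < card ?A ^ L"
    using m by (simp add: card_A)
  with size have "0 < M"
    by (cases "M = 0") (auto simp: M_def)
  obtain cw where cw: "bij_betw cw {0..<M} C"
    using ex_bij_betw_nat_finite[OF \<open>finite C\<close>] by (auto simp: M_def)
  have cwC: "cw i \<in> C" if "i < M" for i
    using cw that by (auto simp: bij_betw_def)
  have cw_grid: "cw i n \<in> ?A" if "i < M" "n < L" for i n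
    using cwC[OF that(1)] C that(2) by (auto simp: PiE_iff)
  have "good_code a b P eps (7 * L) (\<lambda>_ _. M) (tdma_enc cw) (tdma_dec L M t \<tau> cw)"
  proof (rule tdma_good_code[OF a L])
    show "1 \<le> M"
      using \<open>0 < M\<close> by simp
    show "0 \<le> P"
      using P by (rule order_trans[rotated]) simp
    show "2 * t < hamming L (cw i) (cw j)" if "i < M" "j < M" "i \<noteq> j" for i j
      using cw that by (intro dist cwC) (auto simp: bij_betw_def inj_on_def)
    show "2 * \<tau> / a \<le> cmod (cw i n - cw j n)" if "i < M" "j < M" "n < L" "cw i n \<noteq> cw j n" for i j n
      using grid_separated[OF _ cw_grid cw_grid, of i n j n] that s by (simp add: s_def)
    show "(cmod (cw i n))\<^sup>2 \<le> P" if "i < M" "n < L" for i n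
      using grid_norm_le[OF _ cw_grid[OF that]] s P by (simp add: s_def)
    have "(2 :: real) ^ L = (4 ^ K) ^ t"
      by (simp add: L_def power_mult)
    then have "2 ^ L * ?p ^ Suc t = (4 ^ K * ?p) ^ t * ?p"
      by (simp add: power_mult_distrib mult_ac)
    also have "\<dots> \<le> (4 ^ K * ?p) ^ t * 1"
      by (intro mult_left_mono) auto
    finally show "2 ^ L * ?p ^ Suc t \<le> eps"
      using eps by simp
  qed
  \<comment> \<open>Six users with \<open>M\<close> messages each share \<open>7 * L\<close> channel
    uses, which produces the factor 6/7; the rest is the logarithm of the Gilbert-Varshamov
    bound.\<close>
  moreover have "6 / 7 * ((1 - 1 / real K) * (2 * ln (real m)) - ln 2)
    \<le> (\<Sum>k<(6 :: nat). ln (real M)) / real (7 * L)"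
  proof -
    have "real (m\<^sup>2) ^ L \<le> real M * (2 ^ L * real (m\<^sup>2) ^ (2 * t))"
      using of_nat_mono[OF size, where 'a = real] by (simp add: card_A M_def)
    then have "ln (real (m\<^sup>2) ^ L) \<le> ln (real M * (2 ^ L * real (m\<^sup>2) ^ (2 * t)))"
      using m by (intro ln_mono) auto
    then have "real L * (2 * ln (real m)) \<le> ln (real M) + (real L * ln 2 + 2 * real t * (2 * ln (real m)))"
      using m \<open>0 < M\<close> by (simp add: ln_mult ln_realpow)
    moreover have "2 * real t = real L * (1 / real K)"
      using K by (simp add: L_def)
    ultimately have "real L * (2 * ln (real m))
        \<le> ln (real M) + (real L * ln 2 + real L * (1 / real K) * (2 * ln (real m)))"
      by (simp only:)
    then have "real L * ((1 - 1 / real K) * (2 * ln (real m)) - ln 2) \<le> ln (real M)"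
      by (simp add: algebra_simps)
    then have "(1 - 1 / real K) * (2 * ln (real m)) - ln 2 \<le> ln (real M) / real L"
      using L by (subst pos_le_divide_eq) (simp_all add: mult.commute)
    then have "6 / 7 * ((1 - 1 / real K) * (2 * ln (real m)) - ln 2) \<le> 6 / 7 * (ln (real M) / real L)"
      by (intro mult_left_mono) simp_all
    then show ?thesis
      by simp
  qed
  ultimately show "\<exists>N M enc dec. good_code a b P eps N M enc dec \<and>
      (\<forall>c. 6 / 7 * ((1 - 1 / real K) * (2 * ln (real m)) - ln 2) \<le> (\<Sum>k<6. ln (real (M c k))) / real N)"
    by (intro exI[of _ "7 * L"] exI[of _ "\<lambda>_ _. M"] exI[of _ "tdma_enc cw"]
        exI[of _ "tdma_dec L M t \<tau> cw"] conjI allI)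
qed

section \<open>From achievable rates to the capacity and its limit\<close>

lemma cell_capacity_le:
  assumes "0 < a" "a \<le> b" "0 < P" "0 \<le> r" "cell_rate_achievable a b P r"
  shows "cell_capacity a b P \<le> 6 / 7 * rate_bound a P"
  unfolding cell_capacity_def
proof (rule cSup_least)
  \<comment> \<open>A supremum over the empty set would be uncontrolled, hence the witness
    \<open>r\<close>.\<close>
  show "{r. 0 \<le> r \<and> cell_rate_achievable a b P r} \<noteq> {}"
    using assms by blast
qed (use achievable_le[OF assms(1-3)] in simp)

lemma le_cell_capacity:
  assumes "0 < a" "a \<le> b" "0 < P" "0 \<le> r" "cell_rate_achievable a b P r"
  shows "r \<le> cell_capacity a b P"
  unfolding cell_capacity_def
proof (rule cSup_upper)
  show "bdd_above {r. 0 \<le> r \<and> cell_rate_achievable a b P r}"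
    using achievable_le[OF assms(1-3)] by (intro bdd_aboveI[where M = "6 / 7 * rate_bound a P"]) simp
qed (use assms in simp)

text \<open>The order of choices is essential: \<open>K\<close> determines \<open>\<tau>\<close>,
  which determines the spacing \<open>s\<close>, all before \<open>P\<close>. The floor is the
  largest \<open>m\<close> with \<open>2 * s\<^sup>2 * m\<^sup>2 \<le> P\<close>.\<close>

lemma eventually_cell_rate_achievable:
  assumes ab: "0 < a" "a \<le> b" and K: "2 \<le> K"
  obtains s where "0 < s" and "eventually (\<lambda>P. cell_rate_achievable a b P
      (6 / 7 * ((1 - 1 / real K) * (2 * ln (real (nat \<lfloor>sqrt (P / 2) / s\<rfloor>))) - ln 2))) at_top"
proof -
  obtain \<tau> where \<tau>: "0 < \<tau>" and tail: "measure cgauss {z. \<tau> \<le> cmod z} \<le> 1 / (2 * 4 ^ K)"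
    using cgauss_tail[of "1 / (2 * 4 ^ K)"] by auto
  define s where "s = 2 * \<tau> / a"
  have s: "0 < s"
    using ab \<tau> by (simp add: s_def)
  have "4 ^ K * measure cgauss {z. \<tau> \<le> cmod z} \<le> 4 ^ K * (1 / (2 * 4 ^ K))"
    using tail by (intro mult_left_mono) auto
  then have tail': "4 ^ K * measure cgauss {z. \<tau> \<le> cmod z} < 1"
    by simp
  have "eventually (\<lambda>P. cell_rate_achievable a b P
      (6 / 7 * ((1 - 1 / real K) * (2 * ln (real (nat \<lfloor>sqrt (P / 2) / s\<rfloor>))) - ln 2))) at_top"
    using eventually_ge_at_top[of "2 * s\<^sup>2"]
  proof eventually_elim
    case (elim P)
    let ?m = "nat \<lfloor>sqrt (P / 2) / s\<rfloor>"
    have P: "0 \<le> P"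
      using elim by (rule order_trans[rotated]) simp
    have "s \<le> sqrt (P / 2)"
      using elim s by (intro real_le_rsqrt) simp
    then have m: "1 \<le> ?m"
      using s by (intro le_nat_floor) simp
    have "real ?m \<le> sqrt (P / 2) / s"
      using s P by (intro of_nat_floor) simp
    then have "s * real ?m \<le> sqrt (P / 2)"
      using s by (simp add: field_simps)
    then have "(s * real ?m)\<^sup>2 \<le> (sqrt (P / 2))\<^sup>2"
      using s by (intro power_mono) auto
    then have "2 * s\<^sup>2 * (real ?m)\<^sup>2 \<le> P"
      using P by (simp add: power_mult_distrib)
    then show ?case
      using K by (intro tdma_achievable[OF ab(1) \<tau> _ m tail']) (auto simp: s_def)
  qed
  with s show ?thesis
    by (rule that)
qed

theorem theorem3:
  fixes a b :: real
  assumes "0 < a" and "a \<le> b"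
  shows "((\<lambda>P. cell_capacity a b P / ln P) \<longlongrightarrow> 6 / 7) at_top"
proof -
  \<comment> \<open>The upper bound on the capacity is carried along because it, too, needs a
    nonnegative achievable rate.\<close>
  have lower: "eventually (\<lambda>P. y < cell_capacity a b P / ln P \<and> cell_capacity a b P \<le> 6 / 7 * rate_bound a P) at_top"
    if y: "y < 6 / 7" for y
  proof -
    \<comment> \<open>The loss \<open>1 / K\<close> is made smaller than the gap between
      \<open>y\<close> and 6/7 before \<open>P\<close> grows.\<close>
    have "((\<lambda>K. 6 / 7 * (1 - 1 / real K)) \<longlongrightarrow> 6 / 7) sequentially"
      by real_asymp
    then have "eventually (\<lambda>K. y < 6 / 7 * (1 - 1 / real K)) sequentially"
      using y by (rule order_tendstoD)
    then have "eventually (\<lambda>K. 2 \<le> K \<and> y < 6 / 7 * (1 - 1 / real K)) sequentially"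
      using eventually_ge_at_top[of 2] by eventually_elim simp
    then obtain K where K: "2 \<le> K" and yK: "y < 6 / 7 * (1 - 1 / real K)"
      using eventually_happens'[OF sequentially_bot] by blast
    obtain s where s: "0 < s" and ach: "eventually (\<lambda>P. cell_rate_achievable a b P
        (6 / 7 * ((1 - 1 / real K) * (2 * ln (real (nat \<lfloor>sqrt (P / 2) / s\<rfloor>))) - ln 2))) at_top"
      using eventually_cell_rate_achievable[OF assms K] .
    define \<beta> where "\<beta> = 1 - 1 / real K"
    have \<beta>: "0 < \<beta>"
      using K by (simp add: \<beta>_def)
    let ?r = "\<lambda>P. 6 / 7 * (\<beta> * (2 * ln (real (nat \<lfloor>sqrt (P / 2) / s\<rfloor>))) - ln 2)"
    \<comment> \<open>The constellation size grows like the square root of \<open>P\<close>, so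
      twice its logarithm is \<open>ln P\<close> up to a bounded term.\<close>
    have "((\<lambda>P. ?r P / ln P) \<longlongrightarrow> 6 / 7 * \<beta>) at_top"
      using s \<beta> by real_asymp
    then have "eventually (\<lambda>P. y < ?r P / ln P) at_top"
      using yK unfolding \<beta>_def[symmetric] by (rule order_tendstoD)
    moreover have "eventually (\<lambda>P. 0 \<le> ?r P) at_top"
      using s \<beta> by real_asymp
    ultimately show ?thesis
      using ach[folded \<beta>_def] eventually_gt_at_top[of 1]
    proof eventually_elim
      case (elim P)
      then have "?r P / ln P \<le> cell_capacity a b P / ln P"
        using assms by (intro divide_right_mono le_cell_capacity) auto
      moreover have "cell_capacity a b P \<le> 6 / 7 * rate_bound a P"
        using assms elim by (intro cell_capacity_le[of a b P "?r P"]) auto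
      ultimately show ?case
        using elim by simp
    qed
  qed
  show ?thesis
  proof (rule order_tendstoI)
    show "eventually (\<lambda>P. y < cell_capacity a b P / ln P) at_top" if "y < 6 / 7" for y
      using lower[OF that] by (auto elim: eventually_mono)
    fix y :: real assume y: "6 / 7 < y"
    have "((\<lambda>P. 6 / 7 * rate_bound a P / ln P) \<longlongrightarrow> 6 / 7) at_top"
      unfolding rate_bound_def using assms(1) by real_asymp
    then have "eventually (\<lambda>P. 6 / 7 * rate_bound a P / ln P < y) at_top"
      using y by (rule order_tendstoD)
    \<comment> \<open>Any value below 6/7 would do in place of 0; only the second conjunct of
      \<open>lower\<close> is used.\<close>
    moreover have "eventually (\<lambda>P. cell_capacity a b P \<le> 6 / 7 * rate_bound a P) at_top"
      using lower[of 0] by (auto elim: eventually_mono)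
    ultimately show "eventually (\<lambda>P. cell_capacity a b P / ln P < y) at_top"
      using eventually_gt_at_top[of 1]
    proof eventually_elim
      case (elim P)
      then have "cell_capacity a b P / ln P \<le> 6 / 7 * rate_bound a P / ln P"
        by (intro divide_right_mono) auto
      with elim show ?case by simp
    qed
  qed
qed

end
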